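(* Let $G$ be a locally compact commutative group and let $\mathcal{H}$ be a complex Hilbert space. Let $\Phi: G\to\mathbf{B}(\mathcal{H})$ be a uniformly bounded operator-valued cosine function. Then there exist an invertible operator $S\in\mathbf{B}(\mathcal{H})$ and a multiplicative operator $M: G\to\mathbf{B}(\mathcal{H})$ such that $$\Phi(x)=S\,\frac{M(x)+M(-x)}{2}\,S^{-1}\quad\text{for all } x\in G.$$
   Context: The group $G$ is written additively with neutral element $e$. $\mathbf{B}(\mathcal{H})$ is the algebra of all continuous linear operators of $\mathcal{H}$ into itself, with the usual operator norm $\|\cdot\|$, and $I$ is its identity. An operator-valued cosine function is a continuous mapping $\Phi: G\to\mathbf{B}(\mathcal{H})$ satisfying $\Phi(x+y)+\Phi(x-y)=2\Phi(x)\Phi(y)$ for all $x,y\in G$ and $\Phi(e)=I$. It is uniformly bounded if $\sup\{\|\Phi(x)\| : x\in G\}<+\infty$. A multiplicative operator is a continuous mapping $M: G\to\mathbf{B}(\mathcal{H})$ with $M(x+y)=M(x)M(y)$ for all $x,y\in G$ and $M(e)=I$. *)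

theory Defs
  imports "HOL-Analysis.Analysis"
begin

text \<open>
  Complex Hilbert spaces. The class extends \<open>banach\<close> so that the library type
  \<open>'h \<Rightarrow>\<^sub>L 'h\<close> of bounded (real-linear) maps, with its operator norm, is available;
  axiom \<open>scaleR_scaleC\<close> says that the real structure is the restriction of the complex one.
  The inner product is linear in its first argument. Positive definiteness is contained in
  \<open>cinner_self\<close>, since \<open>norm\<close> is already a norm.
\<close>

class complex_hilbert = banach +
  fixes scaleC :: "complex \<Rightarrow> 'a \<Rightarrow> 'a"  (infixr \<open>*\<^sub>C\<close> 75)
    and cinner :: "'a \<Rightarrow> 'a \<Rightarrow> complex"
  assumes scaleC_add_right: "c *\<^sub>C (x + y) = c *\<^sub>C x + c *\<^sub>C y"
    and scaleC_add_left: "(c + d) *\<^sub>C x = c *\<^sub>C x + d *\<^sub>C x"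
    and scaleC_scaleC: "c *\<^sub>C d *\<^sub>C x = (c * d) *\<^sub>C x"
    and scaleR_scaleC: "r *\<^sub>R x = complex_of_real r *\<^sub>C x"
    and cinner_commute: "cinner x y = cnj (cinner y x)"
    and cinner_add_left: "cinner (x + y) z = cinner x z + cinner y z"
    and cinner_scaleC_left: "cinner (c *\<^sub>C x) y = c * cinner x y"
    and cinner_self: "cinner x x = complex_of_real ((norm x)\<^sup>2)"

instantiation complex :: complex_hilbert
begin

definition scaleC_complex :: "complex \<Rightarrow> complex \<Rightarrow> complex"
  where "scaleC_complex c x = c * x"

definition cinner_complex :: "complex \<Rightarrow> complex \<Rightarrow> complex"
  where "cinner_complex x y = x * cnj y"

instance
proof
  fix x :: complex
  show "cinner x x = complex_of_real ((norm x)\<^sup>2)"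
    by (simp only: cinner_complex_def complex_norm_square)
qed (simp_all add: scaleC_complex_def cinner_complex_def scaleR_conv_of_real distrib_left distrib_right
  mult.assoc mult.commute)

end

text \<open>
  The algebra \<open>B(H)\<close>: the complex-linear elements of \<open>'h \<Rightarrow>\<^sub>L 'h\<close>. Its operator norm is the
  norm of \<open>'h \<Rightarrow>\<^sub>L 'h\<close>, its product is \<open>o\<^sub>L\<close> and its identity is \<open>id_blinfun\<close>.
\<close>

definition bounded_operators :: "('h::complex_hilbert \<Rightarrow>\<^sub>L 'h) set"
  where "bounded_operators =
    {T. \<forall>c x. blinfun_apply T (c *\<^sub>C x) = c *\<^sub>C blinfun_apply T x}"

definition cosine_function :: "('g::topological_ab_group_add \<Rightarrow> ('h::complex_hilbert \<Rightarrow>\<^sub>L 'h)) \<Rightarrow> bool"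
  where "cosine_function \<Phi> \<longleftrightarrow>
    range \<Phi> \<subseteq> bounded_operators \<and>
    continuous_on UNIV \<Phi> \<and>
    (\<forall>x y. \<Phi> (x + y) + \<Phi> (x - y) = 2 *\<^sub>R (\<Phi> x o\<^sub>L \<Phi> y)) \<and>
    \<Phi> 0 = id_blinfun"

definition uniformly_bounded :: "('g \<Rightarrow> ('h::complex_hilbert \<Rightarrow>\<^sub>L 'h)) \<Rightarrow> bool"
  where "uniformly_bounded \<Phi> \<longleftrightarrow> bdd_above (range (\<lambda>x. norm (\<Phi> x)))"

definition multiplicative_operator ::
  "('g::topological_ab_group_add \<Rightarrow> ('h::complex_hilbert \<Rightarrow>\<^sub>L 'h)) \<Rightarrow> bool"
  where "multiplicative_operator M \<longleftrightarrow>
    range M \<subseteq> bounded_operators \<and>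
    continuous_on UNIV M \<and>
    (\<forall>x y. M (x + y) = M x o\<^sub>L M y) \<and>
    M 0 = id_blinfun"

end

theory Submission
  imports Defs
begin

text \<open>
  A bounded cosine function on an abelian group should be, up to similarity, a family of cosines of
  self-adjoint operators, and \<open>M = cos + \<i> sin\<close>. The difficulty is to find the sine: the cosine determines
  \<open>sin x sin y = (\<Phi> (x - y) - \<Phi> (x + y)) / 2\<close> and nothing more, so that even for
  \<open>H = \<complex>\<close> a sign has to be chosen, and on a general Hilbert space the choice may differ from one
  part of the spectrum to another.

  Symmetry comes from amenability. An abelian group has an invariant mean
  (\<open>invariant_mean_exists\<close>, by the Hahn-Banach theorem), and averaging
  \<open>\<langle>\<Phi> x u, \<Phi> x v\<rangle>\<close> over \<open>x\<close> gives an inner product for which all \<open>\<Phi> y\<close> are symmetric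
  contractions. It could a priori degenerate; that it is equivalent to the original one follows
  from the cosine equation (\<open>cosine_twice_estimate\<close>).

  For the sine, write \<open>D x y\<close> for the prescribed product \<open>sin x sin y\<close>. For a single \<open>z\<close>, let
  \<open>R\<close> be a symmetric square root of \<open>D z z = I - (\<Phi> z)\<^sup>2\<close>; declaring \<open>sin z = R\<close> forces
  \<open>sin x (R v) = D x z v\<close>, and this defines a sine on the range of \<open>R\<close>, bounded because
  \<open>(D x z)\<^sup>2 = D x x D z z\<close>. What is orthogonal to that range is untouched, and there another \<open>z\<close>
  can be used. Zorn's lemma, applied to partially defined sines whose domains have an invariant
  orthogonal complement, leaves in the end a complement on which all \<open>D z z\<close> vanish; there the
  sine is \<open>0\<close> (\<open>total_sine_graph_exists\<close>). The resulting densely defined operators extend by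
  continuity (\<open>sine_exists\<close>).

  The identity \<open>S x S y = D x y\<close> and the symmetry of \<open>S\<close> already imply everything else: a vector
  that lies in a sum of ranges of the \<open>S x\<close> and is annihilated by all \<open>S z\<close> is zero, which yields the
  oddness of \<open>S\<close>, its addition theorem and its commutation with \<open>\<Phi>\<close>. Hence
  \<open>M x = \<Phi> x + \<i> S x\<close> is multiplicative with \<open>(M x + M (- x)) / 2 = \<Phi> x\<close>. Norm continuity is automatic:
  the norm of \<open>S x\<close> is at most a constant times the square root of the norm of \<open>I - (\<Phi> x)\<^sup>2\<close>, so
  \<open>M\<close> is continuous at \<open>0\<close>, hence everywhere. This \<open>M\<close> represents \<open>\<Phi>\<close>
  itself, so that the identity can be taken as the similarity; the auxiliary inner product serves
  only to construct \<open>M\<close>.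
\<close>

section \<open>Dominated linear functionals\<close>

definition sublinear :: "('v::real_vector \<Rightarrow> real) \<Rightarrow> bool"
  where "sublinear q \<longleftrightarrow>
    (\<forall>x y. q (x + y) \<le> q x + q y) \<and> (\<forall>r>0. \<forall>x. q (r *\<^sub>R x) \<le> r * q x)"

lemma sublinear_add: "sublinear q \<Longrightarrow> q (x + y) \<le> q x + q y"
  and sublinear_scale_le: "sublinear q \<Longrightarrow> r > 0 \<Longrightarrow> q (r *\<^sub>R x) \<le> r * q x"
  by (auto simp: sublinear_def)

lemma sublinear_scale:
  assumes "sublinear q" and "r > 0"
  shows "q (r *\<^sub>R x) = r * q x"
proof -
  have "q ((1 / r) *\<^sub>R (r *\<^sub>R x)) \<le> (1 / r) * q (r *\<^sub>R x)"
    using assms by (intro sublinear_scale_le) auto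
  then have "r * q x \<le> q (r *\<^sub>R x)"
    using assms(2) by (simp add: field_simps)
  then show ?thesis
    using sublinear_scale_le[OF assms, of x] by linarith
qed

lemma sublinear_0: "sublinear q \<Longrightarrow> q 0 = 0"
  using sublinear_scale[of q 2 0] by simp

lemma sublinear_ge_minus: "sublinear q \<Longrightarrow> - q (- x) \<le> q x"
  using sublinear_add[of q x "- x"] sublinear_0[of q] by simp

text \<open>
  The infimum of a family is sublinear as soon as the two inequalities hold up to a change of
  index. It serves both for the lower bounds of chains and for the lowering of a single functional
  along a direction.
\<close>

lemma sublinear_INF:
  assumes "I \<noteq> {}"
    and bdd: "\<And>x. bdd_below ((\<lambda>i. Q i x) ` I)"
    and add: "\<And>i j x y. i \<in> I \<Longrightarrow> j \<in> I \<Longrightarrow> \<exists>k\<in>I. Q k (x + y) \<le> Q i x + Q j y"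
    and scale: "\<And>i r x. i \<in> I \<Longrightarrow> r > 0 \<Longrightarrow> \<exists>k\<in>I. Q k (r *\<^sub>R x) \<le> r * Q i x"
  shows "sublinear (\<lambda>x. INF i\<in>I. Q i x)"
  unfolding sublinear_def
proof (intro conjI allI impI)
  fix x y
  have le: "(INF i\<in>I. Q i (x + y)) \<le> Q i x + Q j y" if "i \<in> I" "j \<in> I" for i j
    using add[OF that, of x y] by (auto intro: order_trans[OF cINF_lower[OF bdd]])
  have "(INF i\<in>I. Q i (x + y)) - Q j y \<le> (INF i\<in>I. Q i x)" if "j \<in> I" for j
    using le[OF _ that] by (intro cINF_greatest[OF assms(1)]) (simp add: algebra_simps)
  then have "(INF i\<in>I. Q i (x + y)) - (INF i\<in>I. Q i x) \<le> (INF j\<in>I. Q j y)"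
    by (intro cINF_greatest[OF assms(1)]) (simp add: algebra_simps)
  then show "(INF i\<in>I. Q i (x + y)) \<le> (INF i\<in>I. Q i x) + (INF j\<in>I. Q j y)"
    by simp
next
  fix r :: real and x
  assume r: "r > 0"
  have "(INF i\<in>I. Q i (r *\<^sub>R x)) \<le> r * Q i x" if "i \<in> I" for i
    using scale[OF that r, of x] by (auto intro: order_trans[OF cINF_lower[OF bdd]])
  then have "(INF i\<in>I. Q i (r *\<^sub>R x)) / r \<le> (INF i\<in>I. Q i x)"
    using r by (intro cINF_greatest[OF assms(1)]) (simp add: field_simps)
  then show "(INF i\<in>I. Q i (r *\<^sub>R x)) \<le> r * (INF i\<in>I. Q i x)"
    using r by (simp add: field_simps)
qed

text \<open>
  If \<open>q\<close> is minimal, then it cannot be lowered along a direction \<open>h\<close>: the infimum over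
  \<open>t \<ge> 0\<close> of \<open>q (x + t h) - t q h\<close> is again sublinear and below \<open>q\<close>, so it equals \<open>q\<close>, and \<open>t = 1\<close>
  gives the reverse of subadditivity.
\<close>

lemma minimal_sublinear_linear:
  assumes q: "sublinear q"
    and minimal: "\<And>q'. sublinear q' \<Longrightarrow> (\<And>x. q' x \<le> q x) \<Longrightarrow> q' = q"
  shows "linear q"
proof -
  have superadd: "q x + q h \<le> q (x + h)" for x h
  proof -
    let ?Q = "\<lambda>t x. q (x + t *\<^sub>R h) - t * q h"
    let ?q = "\<lambda>x. INF t\<in>{0..}. ?Q t x"
    have scale: "q (t *\<^sub>R h) = t * q h" if "t \<ge> 0" for t
      using that sublinear_scale[OF q, of t h] sublinear_0[OF q] by (cases "t = 0") auto
    have "- q (- x) \<le> ?Q t x" if "t \<ge> 0" for t x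
      using sublinear_add[OF q, of "x + t *\<^sub>R h" "- x"] scale[OF that] by simp
    then have bdd: "bdd_below ((\<lambda>t. ?Q t x) ` {0..})" for x
      by (intro bdd_belowI2[where m = "- q (- x)"]) auto
    have "sublinear ?q"
    proof (rule sublinear_INF[OF _ bdd])
      fix s t :: real and x y
      assume "s \<in> {0..}" "t \<in> {0..}"
      moreover have "?Q (s + t) (x + y) \<le> ?Q s x + ?Q t y"
        using sublinear_add[OF q, of "x + s *\<^sub>R h" "y + t *\<^sub>R h"] by (simp add: algebra_simps)
      ultimately show "\<exists>k\<in>{0..}. ?Q k (x + y) \<le> ?Q s x + ?Q t y"
        by (intro bexI[of _ "s + t"]) auto
    next
      fix t r :: real and x
      assume "t \<in> {0..}" "r > 0"
      moreover have "?Q (r * t) (r *\<^sub>R x) \<le> r * ?Q t x"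
        using sublinear_scale_le[OF q \<open>r > 0\<close>, of "x + t *\<^sub>R h"] by (simp add: algebra_simps)
      ultimately show "\<exists>k\<in>{0..}. ?Q k (r *\<^sub>R x) \<le> r * ?Q t x"
        by (intro bexI[of _ "r * t"]) auto
    qed auto
    moreover have le: "?q x \<le> ?Q t x" if "t \<ge> 0" for t x
      using that by (intro cINF_lower[OF bdd]) auto
    then have "?q x \<le> q x" for x
      using le[of 0 x] by simp
    ultimately have "?q = q"
      by (rule minimal)
    then have "?q x = q x"
      by (rule fun_cong)
    then show ?thesis
      using le[of 1 x] by simp
  qed
  have add: "q (x + y) = q x + q y" for x y
    using superadd[of x y] sublinear_add[OF q, of x y] by linarith
  have minus: "q (- x) = - q x" for x
    using add[of x "- x"] sublinear_0[OF q] by simp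
  have "q (r *\<^sub>R x) = r * q x" for r x
  proof (cases r "0::real" rule: linorder_cases)
    case less
    then show ?thesis
      using sublinear_scale[OF q, of "- r" x] minus[of "r *\<^sub>R x"] by simp
  qed (use sublinear_scale[OF q] sublinear_0[OF q] in auto)
  with add show ?thesis
    by (intro linearI) auto
qed

text \<open>
  Zorn's lemma is applied to the sublinear functionals below the given one, ordered downwards,
  rather than to partial linear functionals: a minimal one is linear.
\<close>

lemma Hahn_Banach_dominated:
  fixes p :: "'v::real_vector \<Rightarrow> real"
  assumes p: "sublinear p"
  shows "\<exists>f. linear f \<and> (\<forall>x. f x \<le> p x)"
proof -
  let ?A = "{q. sublinear q \<and> (\<forall>x. q x \<le> p x)}"
  let ?P = "\<lambda>q q' :: 'v \<Rightarrow> real. \<forall>x. q' x \<le> q x"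
  have "\<exists>q\<in>?A. \<forall>q'\<in>?A. ?P q q' \<longrightarrow> q' = q"
  proof (rule predicate_Zorn)
    show "partial_order_on ?A (relation_of ?P ?A)"
      by (rule partial_order_on_relation_ofI) (auto intro: order_trans intro!: ext antisym)
    fix C assume "C \<in> Chains (relation_of ?P ?A)"
    then have C: "C \<subseteq> ?A" and chain: "\<And>q q'. q \<in> C \<Longrightarrow> q' \<in> C \<Longrightarrow> ?P q q' \<or> ?P q' q"
      by (auto simp: Chains_def relation_of_def)
    show "\<exists>u\<in>?A. \<forall>q\<in>C. ?P q u"
    proof (cases "C = {}")
      case True
      then show ?thesis
        using p by auto
    next
      case False
      have "- p (- x) \<le> q x" if "q \<in> C" for q x
        using that C sublinear_ge_minus[of q x] by (smt (verit) mem_Collect_eq subsetD)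
      then have bdd: "bdd_below ((\<lambda>q. q x) ` C)" for x
        by (intro bdd_belowI2) auto
      let ?u = "\<lambda>x. INF q\<in>C. q x"
      have "sublinear ?u"
      proof (rule sublinear_INF[OF False bdd])
        fix q q' x y
        assume qq: "q \<in> C" "q' \<in> C"
        then obtain k where "k \<in> C" "\<forall>x. k x \<le> q x" "\<forall>x. k x \<le> q' x"
          using chain[OF qq] by blast
        moreover have "k (x + y) \<le> k x + k y"
          using \<open>k \<in> C\<close> C by (auto intro: sublinear_add)
        ultimately show "\<exists>k\<in>C. k (x + y) \<le> q x + q' y"
          by (meson add_mono order_trans)
      next
        fix q r x assume "q \<in> C" "r > (0::real)"
        then show "\<exists>k\<in>C. k (r *\<^sub>R x) \<le> r * q x"
          using C by (auto intro: sublinear_scale_le)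
      qed
      moreover have le: "?u x \<le> q x" if "q \<in> C" for q x
        using that by (intro cINF_lower[OF bdd])
      moreover have "?u x \<le> p x" for x
      proof -
        obtain q where "q \<in> C"
          using False by blast
        then have "q x \<le> p x"
          using C by blast
        then show ?thesis
          using le[OF \<open>q \<in> C\<close>, of x] by linarith
      qed
      ultimately show ?thesis
        by (intro bexI[of _ ?u]) auto
    qed
  qed
  then obtain q where q: "sublinear q" "\<And>x. q x \<le> p x"
    and max: "\<And>q'. q' \<in> ?A \<Longrightarrow> ?P q q' \<Longrightarrow> q' = q"
    by blast
  have "linear q"
  proof (rule minimal_sublinear_linear[OF q(1)])
    fix q' :: "'v \<Rightarrow> real" assume q': "sublinear q'" "\<And>x. q' x \<le> q x"
    then have "q' x \<le> p x" for x
      using q(2) order_trans by blast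
    with q' show "q' = q"
      by (intro max) auto
  qed
  with q show ?thesis
    by blast
qed

section \<open>An invariant mean on an abelian topological group\<close>

definition translate_avg :: "'g list \<Rightarrow> ('g::ab_group_add \<Rightarrow> real) \<Rightarrow> 'g \<Rightarrow> real"
  where "translate_avg gs f x = (\<Sum>g\<leftarrow>gs. f (x + g)) / real (length gs)"

lemma translate_avg_add:
  "translate_avg gs (\<lambda>x. f x + g x) = (\<lambda>x. translate_avg gs f x + translate_avg gs g x)"
  by (rule ext) (simp add: translate_avg_def sum_list_addf add_divide_distrib)

lemma translate_avg_mult:
  "translate_avg gs (\<lambda>x. r * f x) x = r * translate_avg gs f x"
  by (simp add: translate_avg_def sum_list_const_mult)

lemma translate_avg_le:
  assumes "gs \<noteq> []" and "\<And>x. f x \<le> c"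
  shows "translate_avg gs f x \<le> c"
proof -
  have "(\<Sum>g\<leftarrow>gs. f (x + g)) \<le> (\<Sum>g\<leftarrow>gs. c)"
    by (intro sum_list_mono assms)
  then show ?thesis
    using assms(1) by (simp add: translate_avg_def sum_list_triv field_simps)
qed

lemma translate_avg_ge:
  assumes "gs \<noteq> []" and "\<And>x. c \<le> f x"
  shows "c \<le> translate_avg gs f x"
  using translate_avg_le[OF assms(1), of "\<lambda>x. - f x" "- c" x] assms(2)
    translate_avg_mult[of gs "- 1" f x] by simp

lemma translate_avg_compose:
  "translate_avg [g + h. g \<leftarrow> gs, h \<leftarrow> hs] f x = translate_avg gs (translate_avg hs f) x"
proof -
  have "(\<Sum>k\<leftarrow>[g + h. g \<leftarrow> gs, h \<leftarrow> hs]. f (x + k)) = (\<Sum>g\<leftarrow>gs. \<Sum>h\<leftarrow>hs. f (x + g + h))"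
    by (induction gs) (simp_all add: o_def add.assoc)
  moreover have "length [g + h. g \<leftarrow> gs, h \<leftarrow> hs] = length gs * length hs"
    by (induction gs) simp_all
  moreover have "(\<Sum>g\<leftarrow>gs. (\<Sum>h\<leftarrow>hs. f (x + g + h)) / real (length hs)) =
      (\<Sum>g\<leftarrow>gs. \<Sum>h\<leftarrow>hs. f (x + g + h)) / real (length hs)"
    by (induction gs) (simp_all add: add_divide_distrib)
  ultimately show ?thesis
    by (simp add: translate_avg_def)
qed

lemma translate_avg_commute:
  "translate_avg gs (translate_avg hs f) x = translate_avg hs (translate_avg gs f) x"
proof -
  have "(\<Sum>g\<leftarrow>gs. \<Sum>h\<leftarrow>hs. f (x + g + h)) = (\<Sum>h\<leftarrow>hs. \<Sum>g\<leftarrow>gs. f (x + h + g))"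
    by (induction gs) (simp_all add: sum_list_addf add.commute add.left_commute)
  moreover have "(\<Sum>g\<leftarrow>gs. (\<Sum>h\<leftarrow>hs. f (x + g + h)) / real (length hs)) =
      (\<Sum>g\<leftarrow>gs. \<Sum>h\<leftarrow>hs. f (x + g + h)) / real (length hs)" for gs hs
    by (induction gs) (simp_all add: add_divide_distrib)
  ultimately show ?thesis
    by (simp add: translate_avg_def mult.commute)
qed

text \<open>
  The sum telescopes, so averaging over \<open>0, y, \<dots>, (n - 1) y\<close> nearly annihilates the difference
  between a bounded function and its translate by \<open>y\<close>.
\<close>

lemma translate_avg_multiples:
  "n > 0 \<Longrightarrow> translate_avg (map (\<lambda>k. \<Sum>i<k. y) [0..<n]) (\<lambda>x. f (x + y) - f x) x =
     (f (x + (\<Sum>i<n. y)) - f x) / real n"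
proof -
  have "(\<Sum>k<n. f (x + (\<Sum>i<k. y) + y) - f (x + (\<Sum>i<k. y))) = f (x + (\<Sum>i<n. y)) - f x"
    using sum_lessThan_telescope[of "\<lambda>k. f (x + (\<Sum>i<k. y))" n] by (simp add: add.assoc)
  then show ?thesis
    by (simp add: translate_avg_def o_def interv_sum_list_conv_sum_set_nat atLeast0LessThan)
qed

lemma bcontfun_bounds: "- norm f \<le> apply_bcontfun f x" "apply_bcontfun f x \<le> norm f"
  for f :: "'g::topological_space \<Rightarrow>\<^sub>C real"
  using norm_bounded[of f x] by auto

text \<open>
  The infimum of all upper bounds of averages of finitely many translates of the function. A linear
  functional below it is automatically positive, normalized and invariant.
\<close>

definition upper_mean :: "('g::topological_ab_group_add \<Rightarrow>\<^sub>C real) \<Rightarrow> real"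
  where "upper_mean f = Inf {c. \<exists>gs. gs \<noteq> [] \<and> (\<forall>x. translate_avg gs f x \<le> c)}"

lemma upper_mean_le:
  fixes f :: "'g::topological_ab_group_add \<Rightarrow>\<^sub>C real"
  assumes "gs \<noteq> []" and "\<And>x. translate_avg gs f x \<le> c"
  shows "upper_mean f \<le> c"
proof -
  have "- norm f \<le> c" if "gs \<noteq> []" "\<forall>x. translate_avg gs f x \<le> c" for gs c
    using translate_avg_ge[of gs "- norm f" f 0] that bcontfun_bounds(1)[of f]
    by (meson order_trans)
  then have "bdd_below {c. \<exists>gs. gs \<noteq> [] \<and> (\<forall>x. translate_avg gs f x \<le> c)}"
    by (intro bdd_belowI[of _ "- norm f"]) auto
  then show ?thesis
    unfolding upper_mean_def using assms by (intro cInf_lower) auto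
qed

lemma upper_mean_greatest:
  fixes f :: "'g::topological_ab_group_add \<Rightarrow>\<^sub>C real"
  assumes "\<And>gs c. gs \<noteq> [] \<Longrightarrow> (\<And>x. translate_avg gs f x \<le> c) \<Longrightarrow> b \<le> c"
  shows "b \<le> upper_mean f"
  unfolding upper_mean_def
proof (rule cInf_greatest)
  have "translate_avg [0] f x \<le> norm f" for x
    using bcontfun_bounds(2)[of f] by (intro translate_avg_le) auto
  then show "{c. \<exists>gs. gs \<noteq> [] \<and> (\<forall>x. translate_avg gs f x \<le> c)} \<noteq> {}"
    by blast
qed (use assms in blast)

text \<open>
  Subadditivity is where commutativity of the group enters: averages that are good for the two
  summands are composed, in either order, into one that is good for the sum.
\<close>

lemma sublinear_upper_mean:
  "sublinear (upper_mean :: ('g::topological_ab_group_add \<Rightarrow>\<^sub>C real) \<Rightarrow> real)"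
  unfolding sublinear_def
proof (intro conjI allI impI)
  fix f g :: "'g \<Rightarrow>\<^sub>C real"
  have le: "upper_mean (f + g) \<le> c + d"
    if gs: "gs \<noteq> []" "\<And>x. translate_avg gs f x \<le> c" and hs: "hs \<noteq> []" "\<And>x. translate_avg hs g x \<le> d"
    for gs hs c d
  proof (rule upper_mean_le)
    show "[g + h. g \<leftarrow> gs, h \<leftarrow> hs] \<noteq> []"
      using gs(1) hs(1) by (cases gs; cases hs) auto
    fix x
    have "translate_avg [g + h. g \<leftarrow> gs, h \<leftarrow> hs] (f + g) x =
        translate_avg hs (translate_avg gs f) x + translate_avg gs (translate_avg hs g) x"
      unfolding translate_avg_compose
      by (simp add: translate_avg_add plus_bcontfun.rep_eq translate_avg_commute[of hs gs])
    also have "\<dots> \<le> c + d"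
      by (intro add_mono translate_avg_le gs hs)
    finally show "translate_avg [g + h. g \<leftarrow> gs, h \<leftarrow> hs] (f + g) x \<le> c + d" .
  qed
  have "upper_mean (f + g) - d \<le> upper_mean f"
    if "hs \<noteq> []" "\<And>x. translate_avg hs g x \<le> d" for hs d
    by (rule upper_mean_greatest) (use le that in \<open>simp add: algebra_simps\<close>)
  then have "upper_mean (f + g) - upper_mean f \<le> upper_mean g"
    by (intro upper_mean_greatest) (simp add: algebra_simps)
  then show "upper_mean (f + g) \<le> upper_mean f + upper_mean g"
    by simp
next
  fix r :: real and f :: "'g \<Rightarrow>\<^sub>C real"
  assume r: "r > 0"
  have "upper_mean (r *\<^sub>R f) \<le> r * c"
    if "gs \<noteq> []" "\<And>x. translate_avg gs f x \<le> c" for gs c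
    using that r by (intro upper_mean_le[of gs]) (simp_all add: scaleR_bcontfun.rep_eq translate_avg_mult)
  then have "upper_mean (r *\<^sub>R f) / r \<le> upper_mean f"
    using r by (intro upper_mean_greatest) (simp add: field_simps)
  then show "upper_mean (r *\<^sub>R f) \<le> r * upper_mean f"
    using r by (simp add: field_simps)
qed

lemma upper_mean_translate_diff_le:
  fixes f g :: "'g::topological_ab_group_add \<Rightarrow>\<^sub>C real"
  assumes g: "\<And>x. apply_bcontfun g x = apply_bcontfun f (x + y)"
  shows "upper_mean (g - f) \<le> 0"
proof -
  have le: "upper_mean (g - f) \<le> (2 * norm f) / real n" if "n > 0" for n
  proof (rule upper_mean_le)
    show "map (\<lambda>k. \<Sum>i<k. y) [0..<n] \<noteq> []"
      using that by simp
    fix x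
    have "apply_bcontfun f (x + (\<Sum>i<n. y)) - apply_bcontfun f x \<le> 2 * norm f"
      using bcontfun_bounds(2)[of f "x + (\<Sum>i<n. y)"] bcontfun_bounds(1)[of f x] by linarith
    then show "translate_avg (map (\<lambda>k. \<Sum>i<k. y) [0..<n]) (g - f) x \<le> (2 * norm f) / real n"
      using translate_avg_multiples[OF that, of y f x]
      by (simp add: minus_bcontfun.rep_eq g divide_right_mono)
  qed
  have "(\<lambda>n. (2 * norm f) / real n) \<longlonglongrightarrow> 0"
    by (rule lim_const_over_n)
  then show ?thesis
    using le by (intro LIMSEQ_le_const[of _ 0 "upper_mean (g - f)"]) (auto intro: exI[of _ 1])
qed

text \<open>
  The functional is a total function on \<open>'g \<Rightarrow> real\<close>; only its values on bounded continuous
  functions are constrained.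
\<close>

definition invariant_mean :: "(('g::topological_ab_group_add \<Rightarrow> real) \<Rightarrow> real) \<Rightarrow> bool"
  where "invariant_mean m \<longleftrightarrow>
    (\<forall>f\<in>bcontfun. \<forall>g\<in>bcontfun. m (\<lambda>x. f x + g x) = m f + m g) \<and>
    (\<forall>f\<in>bcontfun. \<forall>r. m (\<lambda>x. r * f x) = r * m f) \<and>
    (\<forall>f\<in>bcontfun. \<forall>g\<in>bcontfun. (\<forall>x. f x \<le> g x) \<longrightarrow> m f \<le> m g) \<and>
    (\<forall>c. m (\<lambda>x. c) = c) \<and>
    (\<forall>f\<in>bcontfun. \<forall>y. m (\<lambda>x. f (x + y)) = m f)"

lemma invariant_mean_exists:
  "\<exists>m :: ('g::topological_ab_group_add \<Rightarrow> real) \<Rightarrow> real. invariant_mean m"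
proof -
  obtain L :: "('g \<Rightarrow>\<^sub>C real) \<Rightarrow> real" where lin: "linear L" and L: "\<And>f. L f \<le> upper_mean f"
    using Hahn_Banach_dominated[OF sublinear_upper_mean] by blast
  have L_le: "L f \<le> c" if "\<And>x. apply_bcontfun f x \<le> c" for f c
  proof (rule order_trans[OF L upper_mean_le])
    show "translate_avg [0] f x \<le> c" for x
      using that by (intro translate_avg_le) auto
  qed simp
  define m where "m f = L (Bcontfun f)" for f
  have B: "apply_bcontfun (Bcontfun f) = f" if "f \<in> bcontfun" for f :: "'g \<Rightarrow> real"
    using that by (rule Bcontfun_inverse)
  have shift: "(\<lambda>x. f (x + y)) \<in> bcontfun" if "f \<in> bcontfun" for f :: "'g \<Rightarrow> real" and y
    using that unfolding bcontfun_def
    by (auto intro!: continuous_on_compose2[of UNIV f] continuous_intros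
        elim!: bounded_subset)
  have transl_le: "L (Bcontfun (\<lambda>x. f (x + y))) \<le> L (Bcontfun f)" if f: "f \<in> bcontfun" for f y
  proof -
    have "L (Bcontfun (\<lambda>x. f (x + y)) - Bcontfun f) \<le> 0"
      by (rule order_trans[OF L], rule upper_mean_translate_diff_le) (simp add: B f shift)
    then show ?thesis
      by (simp add: linear_diff[OF lin])
  qed
  have "invariant_mean m"
    unfolding invariant_mean_def
  proof (intro conjI ballI allI impI)
    fix f g :: "'g \<Rightarrow> real" assume fg: "f \<in> bcontfun" "g \<in> bcontfun"
    have "Bcontfun (\<lambda>x. f x + g x) = Bcontfun f + Bcontfun g"
      by (rule bcontfun_eqI) (simp add: B fg plus_bcontfun.rep_eq plus_cont)
    then show "m (\<lambda>x. f x + g x) = m f + m g"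
      by (simp add: m_def linear_add[OF lin])
    assume le: "\<forall>x. f x \<le> g x"
    have "L (Bcontfun f - Bcontfun g) \<le> 0"
      by (rule L_le) (simp add: minus_bcontfun.rep_eq B fg le[rule_format])
    then show "m f \<le> m g"
      by (simp add: m_def linear_diff[OF lin])
  next
    fix f :: "'g \<Rightarrow> real" and r assume f: "f \<in> bcontfun"
    have "Bcontfun (\<lambda>x. r * f x) = r *\<^sub>R Bcontfun f"
      using scaleR_cont[OF f, of r] by (intro bcontfun_eqI) (simp add: B f scaleR_bcontfun.rep_eq)
    then show "m (\<lambda>x. r * f x) = r * m f"
      by (simp add: m_def linear_scale[OF lin])
  next
    fix c :: real
    have c: "apply_bcontfun (Bcontfun (\<lambda>x::'g. c)) x = c" for x
      by (subst B[OF const_bcontfun]) simp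
    have "L (- Bcontfun (\<lambda>x. c)) \<le> - c"
      by (rule L_le) (simp add: uminus_bcontfun.rep_eq c)
    moreover have "L (Bcontfun (\<lambda>x. c)) \<le> c"
      by (rule L_le) (simp add: c)
    ultimately show "m (\<lambda>x. c) = c"
      by (simp add: m_def linear_neg[OF lin])
  next
    fix f :: "'g \<Rightarrow> real" and y assume f: "f \<in> bcontfun"
    show "m (\<lambda>x. f (x + y)) = m f"
      using transl_le[OF f, of y] transl_le[OF shift[OF f, of y], of "- y"] by (simp add: m_def)
  qed
  then show ?thesis
    by blast
qed

section \<open>Equivalent inner products on a Banach space\<close>

lemma Cauchy_if_dist_le:
  fixes f :: "nat \<Rightarrow> 'a::metric_space" and g :: "nat \<Rightarrow> 'b::metric_space"
  assumes g: "Cauchy g" and le: "\<And>m n. dist (f m) (f n) \<le> C * dist (g m) (g n)"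
  shows "Cauchy f"
proof (rule metric_CauchyI)
  fix e :: real assume e: "e > 0"
  have C: "\<bar>C\<bar> + 1 > 0"
    by simp
  then have "e / (\<bar>C\<bar> + 1) > 0"
    using e by simp
  from metric_CauchyD[OF g this]
  obtain M where M: "\<And>m n. m \<ge> M \<Longrightarrow> n \<ge> M \<Longrightarrow> dist (g m) (g n) < e / (\<bar>C\<bar> + 1)"
    by blast
  have "dist (f m) (f n) < e" if "m \<ge> M" "n \<ge> M" for m n
  proof -
    have "dist (f m) (f n) \<le> (\<bar>C\<bar> + 1) * dist (g m) (g n)"
      by (rule order_trans[OF le]) (intro mult_right_mono, auto)
    also have "\<dots> < e"
      using M[OF that] C by (simp add: field_simps)
    finally show ?thesis .
  qed
  then show "\<exists>M. \<forall>m\<ge>M. \<forall>n\<ge>M. dist (f m) (f n) < e"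
    by blast
qed

text \<open>
  The new inner product depends on the cosine function, hence it cannot be the one of a type class
  instance. Only its real part is needed: complex linearity is recovered from the operator \<open>J\<close> of
  multiplication by the imaginary unit.
\<close>

locale equivalent_inner =
  fixes ip :: "'h::banach \<Rightarrow> 'h \<Rightarrow> real"
  assumes ip_add_left: "ip (u + v) w = ip u w + ip v w"
    and ip_scale_left: "ip (r *\<^sub>R u) w = r * ip u w"
    and ip_commute: "ip u v = ip v u"
    and ip_lower: "\<exists>c>0. \<forall>u. c * (norm u)\<^sup>2 \<le> ip u u"
    and ip_upper: "\<exists>C. \<forall>u. ip u u \<le> C * (norm u)\<^sup>2"
begin

lemma ip_add_right: "ip w (u + v) = ip w u + ip w v"
  by (simp add: ip_commute[of w] ip_add_left)

lemma ip_scale_right: "ip w (r *\<^sub>R u) = r * ip w u"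
  by (simp add: ip_commute[of w] ip_scale_left)

lemma ip_zero [simp]: "ip 0 v = 0" "ip v 0 = 0"
  using ip_scale_left[of 0 0 v] ip_scale_right[of v 0 0] by auto

lemma ip_minus_left: "ip (- u) v = - ip u v"
  using ip_scale_left[of "-1" u v] by simp

lemma ip_minus_right: "ip u (- v) = - ip u v"
  using ip_scale_right[of u "-1" v] by simp

lemma ip_diff_left: "ip (u - v) w = ip u w - ip v w"
  using ip_add_left[of u "- v" w] by (simp add: ip_minus_left)

lemma ip_diff_right: "ip w (u - v) = ip w u - ip w v"
  by (simp add: ip_commute[of w] ip_diff_left)

lemmas ip_simps = ip_add_left ip_add_right ip_scale_left ip_scale_right
  ip_minus_left ip_minus_right ip_diff_left ip_diff_right

lemma ip_ge_0: "0 \<le> ip u u"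
  using ip_lower by (meson mult_nonneg_nonneg less_imp_le order_trans zero_le_power2)

lemma ip_self_eq_0 [simp]: "ip u u = 0 \<longleftrightarrow> u = 0"
proof
  assume *: "ip u u = 0"
  obtain c where "c > 0" "c * (norm u)\<^sup>2 \<le> ip u u"
    using ip_lower by blast
  then have "(norm u)\<^sup>2 \<le> 0"
    using * by (simp add: mult_le_0_iff)
  then show "u = 0"
    by simp
qed simp

lemma ip_eqI: "(\<And>v. ip u v = ip u' v) \<Longrightarrow> u = u'"
  using ip_self_eq_0[of "u - u'"] by (simp add: ip_diff_left)

lemma Cauchy_Schwarz: "(ip u v)\<^sup>2 \<le> ip u u * ip v v"
proof (cases "v = 0")
  case False
  then have pos: "ip v v > 0"
    using ip_ge_0[of v] by (simp add: order_less_le)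
  have "0 \<le> ip (u - (ip u v / ip v v) *\<^sub>R v) (u - (ip u v / ip v v) *\<^sub>R v)"
    by (rule ip_ge_0)
  also have "\<dots> = ip u u - (ip u v)\<^sup>2 / ip v v"
    using pos by (simp add: ip_simps ip_commute[of v u] power2_eq_square field_simps)
  finally show ?thesis
    using pos by (simp add: field_simps)
qed simp

definition nrm :: "'h \<Rightarrow> real" where "nrm u = sqrt (ip u u)"

lemma nrm_ge_0 [simp]: "0 \<le> nrm u"
  by (simp add: nrm_def ip_ge_0)

lemma nrm_power2: "(nrm u)\<^sup>2 = ip u u"
  by (simp add: nrm_def ip_ge_0)

lemma abs_ip_le: "\<bar>ip u v\<bar> \<le> nrm u * nrm v"
proof -
  have "sqrt ((ip u v)\<^sup>2) \<le> sqrt (ip u u * ip v v)"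
    by (intro real_sqrt_le_mono Cauchy_Schwarz)
  then show ?thesis
    by (simp add: nrm_def real_sqrt_mult)
qed

lemma nrm_triangle: "nrm (u + v) \<le> nrm u + nrm v"
proof -
  have "(nrm (u + v))\<^sup>2 = (nrm u)\<^sup>2 + (nrm v)\<^sup>2 + 2 * ip u v"
    by (simp add: nrm_power2 ip_simps ip_commute[of v u])
  also have "\<dots> \<le> (nrm u + nrm v)\<^sup>2"
    using abs_ip_le[of u v] by (simp add: power2_sum)
  finally show ?thesis
    by (rule power2_le_imp_le) simp
qed

lemma nrm_scale: "nrm (r *\<^sub>R u) = \<bar>r\<bar> * nrm u"
  by (simp add: nrm_def ip_simps real_sqrt_mult real_sqrt_abs2 flip: mult.assoc)

lemma nrm_equivalent:
  obtains c C where "c > 0" "C > 0" "\<And>u. c * norm u \<le> nrm u" "\<And>u. nrm u \<le> C * norm u"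
proof -
  obtain c where c: "c > 0" "\<And>u. c * (norm u)\<^sup>2 \<le> ip u u"
    using ip_lower by blast
  obtain C where C: "\<And>u. ip u u \<le> C * (norm u)\<^sup>2"
    using ip_upper by blast
  show ?thesis
  proof (rule that[of "sqrt c" "sqrt (\<bar>C\<bar> + 1)"])
    show "sqrt c * norm u \<le> nrm u" for u
      using real_sqrt_le_mono[OF c(2), of u] by (simp add: nrm_def real_sqrt_mult)
    have "ip u u \<le> (\<bar>C\<bar> + 1) * (norm u)\<^sup>2" for u
      using C[of u] by (rule order_trans) (intro mult_right_mono, auto)
    from real_sqrt_le_mono[OF this] show "nrm u \<le> sqrt (\<bar>C\<bar> + 1) * norm u" for u
      by (simp add: nrm_def real_sqrt_mult)
  qed (use c in auto)
qed

lemma bounded_bilinear_ip: "bounded_bilinear ip"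
proof
  obtain c C where C: "C > 0" "\<And>u. nrm u \<le> C * norm u"
    using nrm_equivalent by metis
  have "norm (ip u v) \<le> norm u * norm v * (C * C)" for u v
  proof -
    have "nrm u * nrm v \<le> (C * norm u) * (C * norm v)"
      using C by (intro mult_mono) auto
    then show ?thesis
      using abs_ip_le[of u v] by (simp add: mult_ac)
  qed
  then show "\<exists>K. \<forall>a b. norm (ip a b) \<le> norm a * norm b * K"
    by blast
qed (simp_all add: ip_simps)

lemmas tendsto_ip = bounded_bilinear.tendsto[OF bounded_bilinear_ip]

text \<open>
  If \<open>T = A\<^sup>* A\<close>, then the norm of \<open>A\<close> is controlled by the square root of that of \<open>T\<close>.
  The lemma is stated for the single vector \<open>a = A u\<close>, so that it applies before \<open>A\<close> is known to be
  an operator.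
\<close>

lemma norm_bound_if_ip_eq:
  "\<exists>L\<ge>0. \<forall>(T :: 'h \<Rightarrow>\<^sub>L 'h) u a. ip a a = ip (blinfun_apply T u) u \<longrightarrow>
    norm a \<le> L * sqrt (norm T) * norm u"
proof -
  obtain c where c: "c > 0" "\<And>u. c * norm u \<le> nrm u"
    using nrm_equivalent by metis
  obtain K where K: "K > 0" "\<And>a b. norm (ip a b) \<le> norm a * norm b * K"
    using bounded_bilinear.pos_bounded[OF bounded_bilinear_ip] by blast
  have "norm a \<le> sqrt K / c * sqrt (norm T) * norm u"
    if eq: "ip a a = ip (blinfun_apply T u) u" for T :: "'h \<Rightarrow>\<^sub>L 'h" and u a
  proof -
    note eq
    also have "ip (blinfun_apply T u) u \<le> norm (T u) * norm u * K"
      using K(2)[of "T u" u] by simp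
    also have "\<dots> \<le> (norm T * norm u) * norm u * K"
      by (intro mult_right_mono norm_blinfun) (use K in auto)
    also have "\<dots> = K * norm T * (norm u)\<^sup>2"
      by (simp add: power2_eq_square mult_ac)
    finally have "nrm a \<le> sqrt (K * norm T * (norm u)\<^sup>2)"
      unfolding nrm_def by (rule real_sqrt_le_mono)
    then have "c * norm a \<le> sqrt K * sqrt (norm T) * norm u"
      using c(2)[of a] by (simp add: real_sqrt_mult)
    then show ?thesis
      using c(1) by (simp add: field_simps)
  qed
  moreover have "sqrt K / c \<ge> 0"
    using c K by simp
  ultimately show ?thesis
    by blast
qed

lemma parallelogram: "ip (u + v) (u + v) + ip (u - v) (u - v) = 2 * ip u u + 2 * ip v v"
  by (simp add: ip_simps)

lemma Cauchy_if_ip_diff_le: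
  assumes "\<And>m n. ip (s m - s n) (s m - s n) \<le> e m + e n" and "e \<longlonglongrightarrow> 0"
  shows "Cauchy s"
proof (rule metric_CauchyI)
  fix r :: real assume r: "r > 0"
  obtain c where c: "c > 0" "\<And>u. c * (norm u)\<^sup>2 \<le> ip u u"
    using ip_lower by blast
  have "c * r\<^sup>2 / 2 > 0"
    using r c by simp
  then obtain N where N: "\<And>n. n \<ge> N \<Longrightarrow> \<bar>e n\<bar> < c * r\<^sup>2 / 2"
    using LIMSEQ_D[OF assms(2)] by (metis diff_zero real_norm_def)
  show "\<exists>M. \<forall>m\<ge>M. \<forall>n\<ge>M. dist (s m) (s n) < r"
  proof (intro exI allI impI)
    fix m n assume "m \<ge> N" "n \<ge> N"
    then have "c * (norm (s m - s n))\<^sup>2 < c * r\<^sup>2"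
      using c(2)[of "s m - s n"] assms(1)[of m n] N[of m] N[of n] by linarith
    then have "(norm (s m - s n))\<^sup>2 < r\<^sup>2"
      using c(1) by simp
    then show "dist (s m) (s n) < r"
      unfolding dist_norm using r by (auto dest: power2_less_imp_less)
  qed
qed

text \<open>
  The projection theorem in the form needed here: a minimizing sequence for the distance of \<open>u\<close> to
  \<open>K\<close> is Cauchy by the parallelogram law, and the difference of \<open>u\<close> and its limit is orthogonal to
  \<open>K\<close>.
\<close>

lemma dense_if_orthogonal_trivial:
  assumes K: "subspace K"
    and perp: "\<And>v. (\<And>u. u \<in> K \<Longrightarrow> ip u v = 0) \<Longrightarrow> v = 0"
  shows "closure K = UNIV"
proof -
  have "u \<in> closure K" for u
  proof -
    let ?q = "\<lambda>v. ip v v"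
    define d where "d = (INF k\<in>K. ?q (u - k))"
    have bdd: "bdd_below ((\<lambda>k. ?q (u - k)) ` K)"
      by (rule bdd_belowI2[of _ 0]) (rule ip_ge_0)
    have d_le: "d \<le> ?q (u - k)" if "k \<in> K" for k
      unfolding d_def by (rule cINF_lower[OF bdd that])
    have "\<exists>k\<in>K. ?q (u - k) < d + 1 / real (Suc n)" for n
    proof -
      have "d < d + 1 / real (Suc n)" by simp
      then show ?thesis
        using subspace_0[OF K] unfolding d_def by (subst (asm) cINF_less_iff[OF _ bdd]) auto
    qed
    then obtain k where k: "\<And>n. k n \<in> K" "\<And>n. ?q (u - k n) < d + 1 / real (Suc n)"
      by metis
    have "?q (k m - k n) \<le> 2 / real (Suc m) + 2 / real (Suc n)" for m n
    proof -
      have "(1/2) *\<^sub>R (k m + k n) \<in> K"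
        by (intro subspace_scale[OF K] subspace_add[OF K] k)
      moreover have "u - (1/2) *\<^sub>R (k m + k n) = (1/2) *\<^sub>R ((u - k m) + (u - k n))"
        by (simp add: algebra_simps flip: scaleR_left_distrib)
      ultimately have "d \<le> ?q ((1/2) *\<^sub>R ((u - k m) + (u - k n)))"
        using d_le by metis
      then have "4 * d \<le> ?q ((u - k m) + (u - k n))"
        by (simp only: ip_scale_left ip_scale_right)
      then have "4 * d \<le> 2 * ?q (u - k m) + 2 * ?q (u - k n) - ?q (k m - k n)"
        using parallelogram[of "u - k m" "u - k n"] ip_minus_left[of "k m - k n"]
          ip_minus_right[of _ "k m - k n"] by simp
      then show ?thesis
        using k(2)[of m] k(2)[of n] by linarith
    qed
    moreover have "(\<lambda>n. 2 / real (Suc n)) \<longlonglongrightarrow> 0"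
      by (rule LIMSEQ_Suc[OF lim_const_over_n])
    ultimately have "Cauchy k"
      by (rule Cauchy_if_ip_diff_le)
    then obtain p where p: "k \<longlonglongrightarrow> p"
      by (auto simp: Cauchy_convergent_iff convergent_def)
    have min: "?q (u - p) \<le> ?q (u - p - h)" if h: "h \<in> K" for h
    proof -
      have "?q (u - p) \<le> d + 0"
      proof (rule LIMSEQ_le)
        show "(\<lambda>n. ?q (u - k n)) \<longlonglongrightarrow> ?q (u - p)"
          by (intro tendsto_ip tendsto_intros p)
        show "(\<lambda>n. d + 1 / real (Suc n)) \<longlonglongrightarrow> d + 0"
          by (intro tendsto_intros LIMSEQ_Suc[OF lim_const_over_n])
      qed (use k(2) less_imp_le in blast)
      moreover have "d \<le> ?q (u - p - h)"
      proof (rule LIMSEQ_le_const)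
        show "(\<lambda>n. ?q (u - k n - h)) \<longlonglongrightarrow> ?q (u - p - h)"
          by (intro tendsto_ip tendsto_intros p)
        show "\<exists>N. \<forall>n\<ge>N. d \<le> ?q (u - k n - h)"
          using d_le[OF subspace_add[OF K k(1) h]] by (simp add: diff_diff_eq)
      qed
      ultimately show ?thesis
        by simp
    qed
    have "u - p = 0"
    proof (rule perp)
      fix h assume h: "h \<in> K"
      show "ip h (u - p) = 0"
      proof (cases "h = 0")
        case False
        then have pos: "ip h h > 0"
          using ip_ge_0[of h] by (simp add: order_less_le)
        \<comment> \<open>The value of \<open>t\<close> minimizes the quadratic polynomial \<open>\<parallel>e - t h\<parallel>\<^sup>2\<close>.\<close>
        define e t where "e = u - p" and "t = ip e h / ip h h"
        have "ip e e \<le> ip (e - t *\<^sub>R h) (e - t *\<^sub>R h)"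
          using min[OF subspace_scale[OF K h]] by (simp add: e_def)
        also have "\<dots> = ip e e - 2 * t * ip e h + t * t * ip h h"
          by (simp add: ip_simps ip_commute[of h e] algebra_simps)
        also have "\<dots> = ip e e - (ip e h)\<^sup>2 / ip h h"
          using pos by (simp add: t_def power2_eq_square field_simps)
        finally have "(ip e h)\<^sup>2 / ip h h \<le> 0"
          by simp
        then have "ip e h = 0"
          using pos by (simp add: divide_le_0_iff)
        then show ?thesis
          by (simp add: ip_commute[of h] e_def)
      qed simp
    qed
    then show ?thesis
      unfolding closure_sequential using k(1) p by auto
  qed
  then show ?thesis
    by auto
qed

definition symmetric :: "('h \<Rightarrow>\<^sub>L 'h) \<Rightarrow> bool"
  where "symmetric T \<longleftrightarrow> (\<forall>u v. ip (T u) v = ip u (T v))"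

lemma symmetricD: "symmetric T \<Longrightarrow> ip (T u) v = ip u (T v)"
  by (simp add: symmetric_def)

text \<open>
  If \<open>B\<close> solves \<open>B = (A + B\<^sup>2) / 2\<close>, then \<open>(I - B)\<^sup>2 = I - A\<close>. The iteration is run in parallel on
  operators and, with \<open>A\<close> replaced by \<open>1\<close>, on numbers; the bounded increasing sequence of numbers
  dominates the increments of the sequence of operators and makes it Cauchy.
\<close>

fun root_approx :: "('h \<Rightarrow>\<^sub>L 'h) \<Rightarrow> nat \<Rightarrow> 'h \<Rightarrow>\<^sub>L 'h"
  where "root_approx A 0 = 0"
  | "root_approx A (Suc n) = (1/2) *\<^sub>R (A + (root_approx A n o\<^sub>L root_approx A n))"

fun root_approx_bound :: "nat \<Rightarrow> real"
  where "root_approx_bound 0 = 0"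
  | "root_approx_bound (Suc n) = (1 + (root_approx_bound n)\<^sup>2) / 2"

lemma root_approx_Suc_apply:
  "root_approx A (Suc n) u = (1/2) *\<^sub>R (A u + root_approx A n (root_approx A n u))"
  by (simp add: blinfun.add_left blinfun.scaleR_left)

lemma root_approx_commute:
  fixes Q A :: "'h \<Rightarrow>\<^sub>L 'h"
  assumes "\<And>u. Q (A u) = A (Q u)"
  shows "Q (root_approx A n u) = root_approx A n (Q u)"
  using assms by (induction n arbitrary: u) (simp_all add: blinfun.bilinear_simps)

lemma root_approx_symmetric:
  assumes "symmetric A"
  shows "symmetric (root_approx A n)"
proof (induction n)
  case (Suc n)
  then show ?case
    using assms by (simp add: symmetric_def blinfun.bilinear_simps ip_simps)
qed (simp add: symmetric_def)

lemma root_approx_bound: "0 \<le> root_approx_bound n \<and> root_approx_bound n \<le> 1"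
proof (induction n)
  case (Suc n)
  then have "(root_approx_bound n)\<^sup>2 \<le> 1"
    by (simp add: power_le_one)
  then show ?case
    by simp
qed simp

lemma root_approx_nrm_le:
  fixes A :: "'h \<Rightarrow>\<^sub>L 'h"
  assumes A: "\<And>u. nrm (A u) \<le> nrm u"
  shows "nrm (root_approx A n u) \<le> root_approx_bound n * nrm u"
proof (induction n arbitrary: u)
  case (Suc n)
  let ?B = "root_approx A n" and ?b = "root_approx_bound n"
  have "nrm (?B (?B u)) \<le> ?b * (?b * nrm u)"
    using Suc[of "?B u"] Suc[of u] root_approx_bound[of n]
    by (meson mult_left_mono order_trans)
  then have "nrm (A u + ?B (?B u)) \<le> nrm u + ?b * (?b * nrm u)"
    using nrm_triangle[of "A u" "?B (?B u)"] A[of u] by linarith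
  then show ?case
    unfolding root_approx_Suc_apply nrm_scale
    by (simp add: power2_eq_square algebra_simps)
qed (simp add: nrm_def)

lemma root_approx_diff_nrm_le:
  fixes A :: "'h \<Rightarrow>\<^sub>L 'h"
  assumes A: "\<And>u. nrm (A u) \<le> nrm u"
  shows "nrm (root_approx A (Suc n) u - root_approx A n u) \<le>
    (root_approx_bound (Suc n) - root_approx_bound n) * nrm u"
proof (induction n arbitrary: u)
  case 0
  show ?case
    using A[of u] by (simp add: blinfun.bilinear_simps nrm_scale)
next
  case (Suc n)
  let ?B = "root_approx A n" and ?B' = "root_approx A (Suc n)"
  let ?b = "root_approx_bound n" and ?b' = "root_approx_bound (Suc n)"
  have comm: "?B (A u) = A (?B u)" for u
    by (rule root_approx_commute[symmetric]) simp
  have comm': "?B' (?B u) = ?B (?B' u)" for u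
    by (rule root_approx_commute[symmetric]) (rule comm)
  define d where "d = ?B' u - ?B u"
  \<comment> \<open>The increment is \<open>(B'\<^sup>2 - B\<^sup>2) / 2 = (B' + B) (B' - B) / 2\<close>, as \<open>B\<close> and \<open>B'\<close> commute.\<close>
  have "root_approx A (Suc (Suc n)) u - ?B' u =
      (1/2) *\<^sub>R (A u + ?B' (?B' u)) - (1/2) *\<^sub>R (A u + ?B (?B u))"
    by (simp only: root_approx_Suc_apply[of A "Suc n" u] root_approx_Suc_apply[of A n u])
  also have "\<dots> = (1/2) *\<^sub>R (?B' (?B' u) - ?B (?B u))"
    by (simp only: scaleR_diff_right[symmetric] add_diff_cancel_left)
  also have "\<dots> = (1/2) *\<^sub>R (?B' d + ?B d)"
    unfolding d_def blinfun.diff_right comm' by simp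
  finally have "nrm (root_approx A (Suc (Suc n)) u - ?B' u) = nrm (?B' d + ?B d) / 2"
    by (simp add: nrm_scale)
  also have "\<dots> \<le> (?b' * nrm d + ?b * nrm d) / 2"
    using nrm_triangle[of "?B' d" "?B d"] root_approx_nrm_le[OF A, of "Suc n" d]
      root_approx_nrm_le[OF A, of n d] by simp
  also have "\<dots> = ((?b' + ?b) / 2) * nrm d"
    by (simp add: field_simps)
  also have "\<dots> \<le> ((?b' + ?b) / 2) * ((?b' - ?b) * nrm u)"
    unfolding d_def using Suc[of u] root_approx_bound[of n] root_approx_bound[of "Suc n"]
    by (intro mult_left_mono) auto
  also have "\<dots> = (root_approx_bound (Suc (Suc n)) - ?b') * nrm u"
  proof -
    have "(?b' + ?b) / 2 * (?b' - ?b) = (1 + ?b'\<^sup>2) / 2 - (1 + ?b\<^sup>2) / 2"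
      by (simp add: power2_eq_square field_simps del: root_approx_bound.simps)
    then have "(?b' + ?b) / 2 * (?b' - ?b) = root_approx_bound (Suc (Suc n)) - ?b'"
      by (simp only: root_approx_bound.simps(2)[of "Suc n"] root_approx_bound.simps(2)[of n, symmetric])
    then show ?thesis
      by (simp only: mult.assoc[symmetric])
  qed
  finally show ?case .
qed

lemma incseq_root_approx_bound: "incseq root_approx_bound"
proof (rule incseq_SucI)
  show "root_approx_bound n \<le> root_approx_bound (Suc n)" for n
    using zero_le_power2[of "1 - root_approx_bound n"]
    by (simp add: power2_eq_square algebra_simps)
qed

lemma root_approx_Cauchy_bound:
  fixes A :: "'h \<Rightarrow>\<^sub>L 'h"
  assumes A: "\<And>u. nrm (A u) \<le> nrm u" and "n \<le> m"
  shows "nrm (root_approx A m u - root_approx A n u) \<le>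
    (root_approx_bound m - root_approx_bound n) * nrm u"
  using \<open>n \<le> m\<close>
proof (induction m rule: dec_induct)
  case base
  then show ?case
    by (simp add: nrm_def)
next
  case (step m)
  have "nrm (root_approx A (Suc m) u - root_approx A n u) \<le>
      nrm (root_approx A (Suc m) u - root_approx A m u) + nrm (root_approx A m u - root_approx A n u)"
    using nrm_triangle[of "root_approx A (Suc m) u - root_approx A m u"
        "root_approx A m u - root_approx A n u"] by (simp del: root_approx.simps)
  then show ?case
    using step.IH root_approx_diff_nrm_le[OF A, of m u]
    by (simp add: algebra_simps del: root_approx.simps root_approx_bound.simps)
qed

lemma convergent_root_approx:
  fixes A :: "'h \<Rightarrow>\<^sub>L 'h"
  assumes A: "\<And>u. nrm (A u) \<le> nrm u"
  shows "convergent (root_approx A)"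
proof -
  let ?b = root_approx_bound
  obtain c C where c: "c > 0" "C > 0" "\<And>u. c * norm u \<le> nrm u" "\<And>u. nrm u \<le> C * norm u"
    using nrm_equivalent by metis
  have le: "norm (root_approx A m - root_approx A n) \<le> C / c * (?b m - ?b n)" if "n \<le> m" for m n
  proof (rule norm_blinfun_bound)
    have mono: "0 \<le> ?b m - ?b n"
      using incseqD[OF incseq_root_approx_bound that] by simp
    then show "0 \<le> C / c * (?b m - ?b n)"
      using c by simp
    fix u
    have "c * norm ((root_approx A m - root_approx A n) u) \<le> (?b m - ?b n) * nrm u"
      using c(3) root_approx_Cauchy_bound[OF A that, of u]
      by (metis blinfun.diff_left order_trans)
    also have "\<dots> \<le> (?b m - ?b n) * (C * norm u)"
      by (intro mult_left_mono c mono)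
    finally show "norm ((root_approx A m - root_approx A n) u) \<le> C / c * (?b m - ?b n) * norm u"
      using c(1) by (simp add: field_simps)
  qed
  have dist_le: "dist (root_approx A m) (root_approx A n) \<le> C / c * dist (?b m) (?b n)" for m n
  proof (cases "n \<le> m")
    case True
    then show ?thesis
      using le[OF True] incseqD[OF incseq_root_approx_bound True] by (simp add: dist_norm)
  next
    case False
    then have "m \<le> n" by simp
    then show ?thesis
      using le[OF \<open>m \<le> n\<close>] incseqD[OF incseq_root_approx_bound \<open>m \<le> n\<close>]
      by (simp add: dist_norm norm_minus_commute)
  qed
  have "Cauchy ?b"
    by (rule incseq_convergent[OF incseq_root_approx_bound, of 1]) (auto simp: root_approx_bound intro: LIMSEQ_imp_Cauchy)
  then have "Cauchy (root_approx A)"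
    using dist_le by (rule Cauchy_if_dist_le)
  then show ?thesis
    by (simp add: Cauchy_convergent_iff)
qed

text \<open>
  The root of \<open>I - A\<close> is a limit of polynomials in \<open>A\<close>, so it commutes with whatever commutes with
  \<open>A\<close>.
\<close>

lemma symmetric_root_exists:
  fixes A :: "'h \<Rightarrow>\<^sub>L 'h"
  assumes A: "symmetric A" "\<And>u. nrm (A u) \<le> nrm u"
  obtains R :: "'h \<Rightarrow>\<^sub>L 'h" where "symmetric R" and "\<And>u. R (R u) = u - A u"
    and "\<And>(Q :: 'h \<Rightarrow>\<^sub>L 'h) u. (\<And>u. Q (A u) = A (Q u)) \<Longrightarrow> Q (R u) = R (Q u)"
proof -
  obtain B where B: "root_approx A \<longlonglongrightarrow> B"
    using convergent_root_approx[OF A(2)] by (auto simp: convergent_def)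
  have Bu: "(\<lambda>n. root_approx A n u) \<longlonglongrightarrow> B u" for u
    by (intro tendsto_intros B)
  have "(\<lambda>n. root_approx A (Suc n)) \<longlonglongrightarrow> (1/2) *\<^sub>R (A + (B o\<^sub>L B))"
    unfolding root_approx.simps
    by (intro tendsto_intros B bounded_bilinear.tendsto[OF bounded_bilinear_blinfun_compose])
  then have B_eq: "B = (1/2) *\<^sub>R (A + (B o\<^sub>L B))"
    using LIMSEQ_Suc[OF B] LIMSEQ_unique by blast
  have B_eq: "2 *\<^sub>R B u = A u + B (B u)" for u
    by (subst B_eq) (simp add: blinfun.bilinear_simps)
  show ?thesis
  proof (rule that[of "id_blinfun - B"])
    have "ip (B u) v = ip u (B v)" for u v
    proof (rule LIMSEQ_unique)
      show "(\<lambda>n. ip (root_approx A n u) v) \<longlonglongrightarrow> ip (B u) v"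
        by (intro tendsto_ip Bu tendsto_const)
      show "(\<lambda>n. ip (root_approx A n u) v) \<longlonglongrightarrow> ip u (B v)"
        unfolding symmetricD[OF root_approx_symmetric[OF A(1)]]
        by (intro tendsto_ip Bu tendsto_const)
    qed
    then show "symmetric (id_blinfun - B)"
      by (simp add: symmetric_def blinfun.bilinear_simps ip_simps)
    show "(id_blinfun - B) ((id_blinfun - B) u) = u - A u" for u
      using B_eq[of u] by (simp add: blinfun.bilinear_simps scaleR_2 algebra_simps)
    fix Q :: "'h \<Rightarrow>\<^sub>L 'h" and u assume Q: "\<And>u. Q (A u) = A (Q u)"
    have "Q (B u) = B (Q u)"
    proof (rule LIMSEQ_unique)
      show "(\<lambda>n. Q (root_approx A n u)) \<longlonglongrightarrow> Q (B u)"
        by (intro tendsto_intros Bu)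
      show "(\<lambda>n. Q (root_approx A n u)) \<longlonglongrightarrow> B (Q u)"
        unfolding root_approx_commute[OF Q] by (rule Bu)
    qed
    then show "Q ((id_blinfun - B) u) = (id_blinfun - B) (Q u)"
      by (simp add: blinfun.bilinear_simps)
  qed
qed

end

section \<open>The choice of a sine\<close>

text \<open>
  The operator \<open>J\<close> stands for multiplication by \<open>\<i>\<close>. For the construction of the sine it matters only
  that it is skew and commutes with \<open>\<Phi>\<close>.
\<close>

locale symmetric_cosine = equivalent_inner ip
  for ip :: "'h::banach \<Rightarrow> 'h \<Rightarrow> real" +
  fixes \<Phi> :: "'g::ab_group_add \<Rightarrow> ('h \<Rightarrow>\<^sub>L 'h)" and J :: "'h \<Rightarrow>\<^sub>L 'h"
  assumes cosine: "\<Phi> x (\<Phi> y u) = (1/2) *\<^sub>R (\<Phi> (x + y) u + \<Phi> (x - y) u)"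
    and \<Phi>_0: "\<Phi> 0 u = u"
    and \<Phi>_symmetric: "symmetric (\<Phi> x)"
    and \<Phi>_nrm_le: "nrm (\<Phi> x u) \<le> nrm u"
    and J_skew: "ip (J u) v = - ip u (J v)"
    and J_\<Phi>: "J (\<Phi> x u) = \<Phi> x (J u)"
begin

lemma \<Phi>_even: "\<Phi> (- x) u = \<Phi> x u"
proof -
  have "\<Phi> x u = (1/2) *\<^sub>R (\<Phi> x u + \<Phi> (- x) u)"
    using cosine[of 0 x u] by (simp add: \<Phi>_0)
  from arg_cong[OF this, of "scaleR 2"] have "2 *\<^sub>R \<Phi> x u = \<Phi> x u + \<Phi> (- x) u"
    by simp
  then show ?thesis
    by (simp add: scaleR_2)
qed

lemma \<Phi>_minus_commute: "\<Phi> (x - y) u = \<Phi> (y - x) u"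
  using \<Phi>_even[of "x - y" u] by simp

lemma \<Phi>_commute: "\<Phi> x (\<Phi> y u) = \<Phi> y (\<Phi> x u)"
  by (simp add: cosine \<Phi>_minus_commute[of x y] add.commute)

text \<open>
  With \<open>\<Phi> = cos\<close> this is \<open>sin x sin y\<close>, by the product formula.
\<close>

definition D :: "'g \<Rightarrow> 'g \<Rightarrow> 'h \<Rightarrow>\<^sub>L 'h"
  where "D x y = (1/2) *\<^sub>R (\<Phi> (x - y) - \<Phi> (x + y))"

lemma D_apply: "D x y u = (1/2) *\<^sub>R (\<Phi> (x - y) u - \<Phi> (x + y) u)"
  by (simp add: D_def blinfun.bilinear_simps)

lemma D_commute: "D x y = D y x"
  by (rule blinfun_eqI) (simp add: D_apply \<Phi>_minus_commute[of x y] add.commute)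

lemma D_minus: "D (- x) y u = - D x y u"
proof -
  have "\<Phi> (- x - y) u = \<Phi> (x + y) u" "\<Phi> (- x + y) u = \<Phi> (x - y) u"
    using \<Phi>_even[of "x + y" u] \<Phi>_even[of "x - y" u] by (simp_all add: algebra_simps)
  then show ?thesis
    by (simp add: D_apply algebra_simps)
qed

lemma D_diag: "D z z u = u - \<Phi> z (\<Phi> z u)"
  by (simp add: D_apply cosine \<Phi>_0 algebra_simps flip: scaleR_left_distrib)

text \<open>
  The relation \<open>sin x sin y sin z sin w = sin x sin z sin y sin w\<close>, which makes \<open>D\<close> a candidate for a
  product; it needs no sine, being a symmetry of the product formula.
\<close>

lemma D_exchange: "D x y (D z w u) = D x z (D y w u)"
proof -
  have *: "D x y (D z w u) = (1/8) *\<^sub>R (\<Phi> (x - y + (z - w)) u + \<Phi> (x - y - (z - w)) u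
      - \<Phi> (x - y + (z + w)) u - \<Phi> (x - y - (z + w)) u
      - \<Phi> (x + y + (z - w)) u - \<Phi> (x + y - (z - w)) u
      + \<Phi> (x + y + (z + w)) u + \<Phi> (x + y - (z + w)) u)" for x y z w
    by (simp add: D_apply blinfun.bilinear_simps cosine scaleR_add_right scaleR_diff_right)
  show ?thesis
    unfolding * by (simp add: algebra_simps)
qed

definition symmetric_commutant :: "('h \<Rightarrow>\<^sub>L 'h) set"
  where "symmetric_commutant = {T. symmetric T \<and> (\<forall>x u. T (\<Phi> x u) = \<Phi> x (T u))}"

lemma commutant_symmetric: "T \<in> symmetric_commutant \<Longrightarrow> ip (T u) v = ip u (T v)"
  by (simp add: symmetric_commutant_def symmetric_def)

lemma commutant_\<Phi>: "T \<in> symmetric_commutant \<Longrightarrow> T (\<Phi> x u) = \<Phi> x (T u)"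
  by (simp add: symmetric_commutant_def)

lemma commutant_D: "T \<in> symmetric_commutant \<Longrightarrow> T (D x y u) = D x y (T u)"
  by (simp add: D_apply blinfun.bilinear_simps commutant_\<Phi>)

lemma D_in_commutant: "D x y \<in> symmetric_commutant"
  using \<Phi>_symmetric
  by (simp add: symmetric_commutant_def symmetric_def D_apply ip_simps blinfun.bilinear_simps
      \<Phi>_commute[of "x - y"] \<Phi>_commute[of "x + y"])

lemmas D_symmetric = commutant_symmetric[OF D_in_commutant]

lemma J_D: "J (D x y u) = D x y (J u)"
  by (simp add: D_apply blinfun.bilinear_simps J_\<Phi>)

lemma root_exists:
  obtains R where "R \<in> symmetric_commutant" and "\<And>u. R (R u) = D z z u"
    and "\<And>T u. T \<in> symmetric_commutant \<Longrightarrow> T (R u) = R (T u)" and "\<And>u. J (R u) = R (J u)"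
proof -
  let ?A = "\<Phi> z o\<^sub>L \<Phi> z"
  have A: "symmetric ?A" "\<And>u. nrm (?A u) \<le> nrm u"
    using \<Phi>_symmetric order_trans[OF \<Phi>_nrm_le \<Phi>_nrm_le] by (auto simp: symmetric_def)
  obtain R :: "'h \<Rightarrow>\<^sub>L 'h" where R: "symmetric R" "\<And>u. R (R u) = u - ?A u"
    and comm: "\<And>(Q :: 'h \<Rightarrow>\<^sub>L 'h) u. (\<And>u. Q (?A u) = ?A (Q u)) \<Longrightarrow> Q (R u) = R (Q u)"
    by (rule symmetric_root_exists[OF A]) blast
  have "\<Phi> x (R u) = R (\<Phi> x u)" for x u
    by (rule comm) (simp add: \<Phi>_commute[of x z])
  then have 1: "R \<in> symmetric_commutant"
    using R(1) by (simp add: symmetric_commutant_def)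
  have 2: "R (R u) = D z z u" for u
    by (simp add: R(2) D_diag)
  have 3: "T (R u) = R (T u)" if "T \<in> symmetric_commutant" for T u
    by (rule comm) (simp add: commutant_\<Phi>[OF that])
  have 4: "J (R u) = R (J u)" for u
    by (rule comm) (simp add: J_\<Phi>)
  show ?thesis
    by (rule that[OF 1 2 3 4])
qed

definition perp :: "('h \<times> ('g \<Rightarrow> 'h)) set \<Rightarrow> 'h set"
  where "perp \<Gamma> = {v. \<forall>(u, w)\<in>\<Gamma>. ip u v = 0}"

lemma perpD: "v \<in> perp \<Gamma> \<Longrightarrow> (u, w) \<in> \<Gamma> \<Longrightarrow> ip u v = 0"
  by (auto simp: perp_def)

text \<open>
  A partially defined sine is encoded by its graph: a pair \<open>(u, w)\<close> records that \<open>sin x u\<close> is to be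
  \<open>w x\<close> for all \<open>x\<close>. The graph is a plain set, without linearity. The first condition is
  \<open>\<langle>sin x u, sin y u'\<rangle> = \<langle>sin x sin y u, u'\<rangle>\<close>, the second symmetry. All conditions survive linear
  combinations and limits, and the first makes the values unique.
\<close>

definition sine_graph :: "('h \<times> ('g \<Rightarrow> 'h)) set \<Rightarrow> bool"
  where "sine_graph \<Gamma> \<longleftrightarrow>
    (\<forall>(u, w)\<in>\<Gamma>. \<forall>(u', w')\<in>\<Gamma>. \<forall>x y.
       ip (w x) (w' y) = ip (D x y u) u' \<and> ip (w x) u' = ip u (w' x)) \<and>
    (\<forall>(u, w)\<in>\<Gamma>. (J u, \<lambda>x. J (w x)) \<in> \<Gamma>)"

lemma sine_graphI:
  assumes "\<And>u w u' w' x y. (u, w) \<in> \<Gamma> \<Longrightarrow> (u', w') \<in> \<Gamma> \<Longrightarrow>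
      ip (w x) (w' y) = ip (D x y u) u' \<and> ip (w x) u' = ip u (w' x)"
    and "\<And>u w. (u, w) \<in> \<Gamma> \<Longrightarrow> (J u, \<lambda>x. J (w x)) \<in> \<Gamma>"
  shows "sine_graph \<Gamma>"
  using assms unfolding sine_graph_def by (intro conjI ballI; clarsimp)

lemma sine_graph_gram:
  "sine_graph \<Gamma> \<Longrightarrow> (u, w) \<in> \<Gamma> \<Longrightarrow> (u', w') \<in> \<Gamma> \<Longrightarrow> ip (w x) (w' y) = ip (D x y u) u'"
  and sine_graph_symmetric:
  "sine_graph \<Gamma> \<Longrightarrow> (u, w) \<in> \<Gamma> \<Longrightarrow> (u', w') \<in> \<Gamma> \<Longrightarrow> ip (w x) u' = ip u (w' x)"
  and sine_graph_J:
  "sine_graph \<Gamma> \<Longrightarrow> (u, w) \<in> \<Gamma> \<Longrightarrow> (J u, \<lambda>x. J (w x)) \<in> \<Gamma>"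
  by (fastforce simp: sine_graph_def)+

text \<open>
  The domain of the sine need not be invariant under the operators commuting with \<open>\<Phi>\<close>, but its
  orthogonal complement is invariant under the symmetric ones, and the sine takes values orthogonal to that complement. Then a sine
  found on part of the complement does not interfere with the one already constructed.
\<close>

definition reducing_graph :: "('h \<times> ('g \<Rightarrow> 'h)) set \<Rightarrow> bool"
  where "reducing_graph \<Gamma> \<longleftrightarrow> sine_graph \<Gamma> \<and>
    (\<forall>v\<in>perp \<Gamma>. (\<forall>T\<in>symmetric_commutant. T v \<in> perp \<Gamma>) \<and>
      (\<forall>(u, w)\<in>\<Gamma>. \<forall>x. ip (w x) v = 0))"

lemma reducing_graph_invariant:
  "reducing_graph \<Gamma> \<Longrightarrow> v \<in> perp \<Gamma> \<Longrightarrow> T \<in> symmetric_commutant \<Longrightarrow> T v \<in> perp \<Gamma>"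
  and reducing_graph_orthogonal:
  "reducing_graph \<Gamma> \<Longrightarrow> v \<in> perp \<Gamma> \<Longrightarrow> (u, w) \<in> \<Gamma> \<Longrightarrow> ip (w x) v = 0"
  by (fastforce simp: reducing_graph_def)+

lemma reducing_graph_Union_chain:
  assumes chain: "subset.chain {\<Gamma>. reducing_graph \<Gamma>} \<C>"
  shows "reducing_graph (\<Union>\<C>)"
proof -
  have red: "reducing_graph \<Gamma>" if "\<Gamma> \<in> \<C>" for \<Gamma>
    using chain that by (auto simp: subset.chain_def)
  then have sine: "sine_graph \<Gamma>" if "\<Gamma> \<in> \<C>" for \<Gamma>
    using that by (simp add: reducing_graph_def)
  have common: "\<exists>\<Gamma>\<in>\<C>. p \<in> \<Gamma> \<and> q \<in> \<Gamma>" if pq: "p \<in> \<Union>\<C>" "q \<in> \<Union>\<C>" for p q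
  proof -
    obtain \<Gamma> \<Gamma>' where "\<Gamma> \<in> \<C>" "p \<in> \<Gamma>" "\<Gamma>' \<in> \<C>" "q \<in> \<Gamma>'"
      using pq by blast
    moreover have "\<Gamma> \<subseteq> \<Gamma>' \<or> \<Gamma>' \<subseteq> \<Gamma>"
      using chain calculation unfolding subset_chain_def by blast
    ultimately show ?thesis
      by blast
  qed
  have "sine_graph (\<Union>\<C>)"
  proof (rule sine_graphI)
    fix u w u' w' x y
    assume "(u, w) \<in> \<Union>\<C>" "(u', w') \<in> \<Union>\<C>"
    then obtain \<Gamma> where "\<Gamma> \<in> \<C>" "(u, w) \<in> \<Gamma>" "(u', w') \<in> \<Gamma>"
      using common by blast
    then show "ip (w x) (w' y) = ip (D x y u) u' \<and> ip (w x) u' = ip u (w' x)"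
      using sine_graph_gram sine_graph_symmetric sine by blast
  next
    fix u w assume "(u, w) \<in> \<Union>\<C>"
    then show "(J u, \<lambda>x. J (w x)) \<in> \<Union>\<C>"
      using sine_graph_J sine by blast
  qed
  moreover have perp: "v \<in> perp \<Gamma>" if "v \<in> perp (\<Union>\<C>)" "\<Gamma> \<in> \<C>" for v \<Gamma>
    using that by (auto simp: perp_def)
  have "T v \<in> perp (\<Union>\<C>)" if "v \<in> perp (\<Union>\<C>)" "T \<in> symmetric_commutant" for v T
  proof -
    have "T v \<in> perp \<Gamma>" if "\<Gamma> \<in> \<C>" for \<Gamma>
      using reducing_graph_invariant[OF red[OF that]] perp that \<open>v \<in> perp (\<Union>\<C>)\<close>
        \<open>T \<in> symmetric_commutant\<close> by blast
    then show ?thesis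
      by (auto simp: perp_def)
  qed
  moreover have "ip (w x) v = 0" if "v \<in> perp (\<Union>\<C>)" "(u, w) \<in> \<Union>\<C>" for v u w x
    using reducing_graph_orthogonal red perp that by blast
  ultimately show ?thesis
    by (fastforce simp: reducing_graph_def)
qed

text \<open>
  The new part of the sine is defined on \<open>R v\<close> by \<open>Q x v\<close>, for \<open>v\<close> orthogonal to the old
  domain. It is used with a root \<open>R\<close> of \<open>D z z\<close> and \<open>Q x = D x z\<close>, and with \<open>R = I\<close>, \<open>Q = 0\<close>.
\<close>

lemma reducing_graph_extend:
  fixes R :: "'h \<Rightarrow>\<^sub>L 'h" and Q :: "'g \<Rightarrow> 'h \<Rightarrow>\<^sub>L 'h"
  assumes \<Gamma>: "reducing_graph \<Gamma>"
    and R: "R \<in> symmetric_commutant" and Q: "\<And>x. Q x \<in> symmetric_commutant"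
    and R_comm: "\<And>T u. T \<in> symmetric_commutant \<Longrightarrow> T (R u) = R (T u)"
    and J: "\<And>u. J (R u) = R (J u)" "\<And>x u. J (Q x u) = Q x (J u)"
    and gram: "\<And>v x y. v \<in> perp \<Gamma> \<Longrightarrow> Q x (Q y v) = D x y (R (R v))"
    and kernel: "\<And>v x. v \<in> perp \<Gamma> \<Longrightarrow> R v = 0 \<Longrightarrow> Q x v = 0"
  shows "reducing_graph (\<Gamma> \<union> (\<lambda>v. (R v, \<lambda>x. Q x v)) ` perp \<Gamma>)"
proof -
  let ?N = "(\<lambda>v. (R v, \<lambda>x. Q x v)) ` perp \<Gamma>"
  have sine: "sine_graph \<Gamma>"
    using \<Gamma> by (simp add: reducing_graph_def)
  note inv = reducing_graph_invariant[OF \<Gamma>] and orth = reducing_graph_orthogonal[OF \<Gamma>]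
  note sym = commutant_symmetric
  have J_perp: "J v \<in> perp \<Gamma>" if v: "v \<in> perp \<Gamma>" for v
    unfolding perp_def
  proof safe
    fix u w assume "(u, w) \<in> \<Gamma>"
    from perpD[OF v sine_graph_J[OF sine this]] show "ip u (J v) = 0"
      using J_skew[of u v] by simp
  qed
  have new_new: "ip (Q x v) (Q y v') = ip (D x y (R v)) (R v')" "ip (Q x v) (R v') = ip (R v) (Q x v')"
    if "v \<in> perp \<Gamma>" "v' \<in> perp \<Gamma>" for v v' x y
  proof -
    have "ip (Q x v) (Q y v') = ip v (D x y (R (R v')))"
      by (simp add: sym[OF Q] gram[OF that(2)])
    then show "ip (Q x v) (Q y v') = ip (D x y (R v)) (R v')"
      by (simp add: sym[OF R] D_symmetric commutant_D[OF R])
    have "ip (Q x v) (R v') = ip (R v) (Q x v')"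
      using sym[OF Q, of x v "R v'"] sym[OF R, of v "Q x v'"] R_comm[OF Q, of x v'] by simp
    then show "ip (Q x v) (R v') = ip (R v) (Q x v')" .
  qed
  \<comment> \<open>Vectors derived from the complement stay in it, so all mixed products vanish.\<close>
  have old_new: "ip (w x) (Q y v) = 0" "ip (D x y u) (R v) = 0" "ip (w x) (R v) = 0" "ip u (Q x v) = 0"
    if "(u, w) \<in> \<Gamma>" "v \<in> perp \<Gamma>" for u w v x y
    using orth[OF inv[OF that(2) Q] that(1)] orth[OF inv[OF that(2) R] that(1)]
      perpD[OF inv[OF that(2) Q] that(1)]
      perpD[OF inv[OF inv[OF that(2) R] D_in_commutant] that(1)]
    by (simp_all add: D_symmetric)
  have "sine_graph (\<Gamma> \<union> ?N)"
  proof (rule sine_graphI)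
    fix u w u' w' x y
    assume 1: "(u, w) \<in> \<Gamma> \<union> ?N" and 2: "(u', w') \<in> \<Gamma> \<union> ?N"
    consider "(u, w) \<in> \<Gamma>" "(u', w') \<in> \<Gamma>"
      | v where "(u, w) \<in> \<Gamma>" "v \<in> perp \<Gamma>" "u' = R v" "w' = (\<lambda>x. Q x v)"
      | v where "(u', w') \<in> \<Gamma>" "v \<in> perp \<Gamma>" "u = R v" "w = (\<lambda>x. Q x v)"
      | v v' where "v \<in> perp \<Gamma>" "u = R v" "w = (\<lambda>x. Q x v)"
        "v' \<in> perp \<Gamma>" "u' = R v'" "w' = (\<lambda>x. Q x v')"
      using 1 2 by blast
    then show "ip (w x) (w' y) = ip (D x y u) u' \<and> ip (w x) u' = ip u (w' x)"
    proof cases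
      case 1
      then show ?thesis
        using sine_graph_gram[OF sine] sine_graph_symmetric[OF sine] by blast
    next
      case 2
      then show ?thesis
        by (simp add: old_new)
    next
      case 3
      then show ?thesis
        using old_new[OF 3(1,2)] by (simp add: ip_commute[of _ "w' _"] ip_commute[of _ u'] D_symmetric)
    next
      case 4
      then show ?thesis
        by (simp add: new_new)
    qed
  next
    fix u w assume "(u, w) \<in> \<Gamma> \<union> ?N"
    then show "(J u, \<lambda>x. J (w x)) \<in> \<Gamma> \<union> ?N"
    proof
      assume "(u, w) \<in> \<Gamma>"
      then show ?thesis
        using sine_graph_J[OF sine] by blast
    next
      assume "(u, w) \<in> ?N"
      then obtain v where "v \<in> perp \<Gamma>" "u = R v" "w = (\<lambda>x. Q x v)"
        by blast
      then have "(J u, \<lambda>x. J (w x)) \<in> ?N"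
        by (intro image_eqI[of _ _ "J v"]) (simp_all add: J J_perp)
      then show ?thesis
        by blast
    qed
  qed
  moreover have perp: "t \<in> perp (\<Gamma> \<union> ?N) \<longleftrightarrow> t \<in> perp \<Gamma> \<and> (\<forall>v\<in>perp \<Gamma>. ip (R v) t = 0)" for t
    by (auto simp: perp_def)
  have "T t \<in> perp (\<Gamma> \<union> ?N)" if t: "t \<in> perp (\<Gamma> \<union> ?N)" and T: "T \<in> symmetric_commutant" for t T
  proof -
    have "ip (R v) (T t) = 0" if "v \<in> perp \<Gamma>" for v
      using t inv[OF that T] unfolding perp by (simp add: sym[OF T, symmetric] R_comm[OF T])
    then show ?thesis
      using t inv[OF _ T] unfolding perp by blast
  qed
  moreover have "ip (w x) t = 0" if t: "t \<in> perp (\<Gamma> \<union> ?N)" and uw: "(u, w) \<in> \<Gamma> \<union> ?N" for t u w x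
    using uw
  proof
    assume "(u, w) \<in> \<Gamma>"
    then show ?thesis
      using t orth unfolding perp by blast
  next
    assume "(u, w) \<in> ?N"
    then obtain v where v: "v \<in> perp \<Gamma>" "w = (\<lambda>x. Q x v)"
      by blast
    have t': "t \<in> perp \<Gamma>" "R t \<in> perp \<Gamma>"
      using t inv[OF _ R] unfolding perp by auto
    then have "ip (R (R t)) t = 0"
      using t unfolding perp by blast
    then have "R t = 0"
      using sym[OF R, of "R t" t] by simp
    then show ?thesis
      using kernel[OF t'(1), of x] sym[OF Q, of x v t] by (simp add: v(2))
  qed
  ultimately show ?thesis
    unfolding reducing_graph_def by blast
qed

text \<open>
  In a maximal graph, a root of \<open>D z z\<close> maps the complement of the domain into the domain, and also
  into the complement; hence \<open>D z z\<close> vanishes there. Then so do all \<open>D x y\<close>, since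
  \<open>(D x y)\<^sup>2 = D x x D y y\<close>, and the sine \<open>0\<close> is admissible on the complement, which is therefore trivial.
\<close>

lemma total_sine_graph_exists:
  obtains \<Gamma> where "sine_graph \<Gamma>" and "perp \<Gamma> = {0}"
proof -
  obtain \<Gamma> where \<Gamma>: "reducing_graph \<Gamma>"
    and max: "\<And>\<Gamma>'. reducing_graph \<Gamma>' \<Longrightarrow> \<Gamma> \<subseteq> \<Gamma>' \<Longrightarrow> \<Gamma>' = \<Gamma>"
    using subset_Zorn'[of "{\<Gamma>. reducing_graph \<Gamma>}"] reducing_graph_Union_chain by auto
  have in_\<Gamma>_0: "u = 0" if "u \<in> perp \<Gamma>" "(u, w) \<in> \<Gamma>" for u w
    using perpD[OF that] by simp
  have D_0: "D z z v = 0" if v: "v \<in> perp \<Gamma>" for z v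
  proof -
    obtain R where R: "R \<in> symmetric_commutant" "\<And>u. R (R u) = D z z u"
      "\<And>T u. T \<in> symmetric_commutant \<Longrightarrow> T (R u) = R (T u)" "\<And>u. J (R u) = R (J u)"
      using root_exists[of z] by blast
    have "reducing_graph (\<Gamma> \<union> (\<lambda>v. (R v, \<lambda>x. D x z v)) ` perp \<Gamma>)"
    proof (rule reducing_graph_extend[OF \<Gamma> R(1) D_in_commutant R(3) R(4) J_D])
      fix v x y
      show "D x z (D y z v) = D x y (R (R v))"
        by (simp add: R(2) D_exchange[of x z])
      assume "R v = 0"
      then have "D z z v = 0"
        using R(2)[of v] by simp
      then have "D x z (D x z v) = 0"
        by (simp add: D_exchange[of x z x])
      then have "ip (D x z v) (D x z v) = 0"
        by (simp add: D_symmetric)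
      then show "D x z v = 0"
        by simp
    qed
    then have "(R v, \<lambda>x. D x z v) \<in> \<Gamma>"
      using max[of "\<Gamma> \<union> (\<lambda>v. (R v, \<lambda>x. D x z v)) ` perp \<Gamma>"] v by blast
    then have "R v = 0"
      by (rule in_\<Gamma>_0[OF reducing_graph_invariant[OF \<Gamma> v R(1)]])
    then show ?thesis
      using R(2)[of v] by simp
  qed
  have D_xy_0: "D x y v = 0" if v: "v \<in> perp \<Gamma>" for x y v
  proof -
    have "D x y (D x y v) = 0"
      using D_0[OF v] by (simp add: D_exchange[of x y x])
    then have "ip (D x y v) (D x y v) = 0"
      by (simp add: D_symmetric)
    then show ?thesis
      by simp
  qed
  let ?\<Gamma>' = "\<Gamma> \<union> (\<lambda>v. (id_blinfun v, \<lambda>x. (0 :: 'h \<Rightarrow>\<^sub>L 'h) v)) ` perp \<Gamma>"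
  have "reducing_graph ?\<Gamma>'"
    by (rule reducing_graph_extend[OF \<Gamma>])
      (simp_all add: symmetric_commutant_def symmetric_def D_xy_0)
  then have \<Gamma>': "?\<Gamma>' = \<Gamma>"
    by (rule max) blast
  have "(v, \<lambda>x. 0) \<in> \<Gamma>" if "v \<in> perp \<Gamma>" for v
    by (subst \<Gamma>'[symmetric]) (use that in auto)
  then have "perp \<Gamma> \<subseteq> {0}"
    using in_\<Gamma>_0 by auto
  moreover have "0 \<in> perp \<Gamma>"
    by (auto simp: perp_def)
  ultimately show ?thesis
    using that \<Gamma> by (auto simp: reducing_graph_def)
qed

end

section \<open>The sine and the exponential of a symmetric cosine function\<close>

text \<open>
  Linear span and sequential closure are taken on graphs as subsets of \<open>'h \<times> ('g \<Rightarrow> 'h)\<close>, with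
  pointwise operations and pointwise convergence in the second component.
\<close>

inductive_set graph_span :: "('h::real_vector \<times> ('g \<Rightarrow> 'h)) set \<Rightarrow> ('h \<times> ('g \<Rightarrow> 'h)) set"
  for \<Gamma> where
    zero: "(0, \<lambda>x. 0) \<in> graph_span \<Gamma>"
  | base: "(u, w) \<in> \<Gamma> \<Longrightarrow> (u, w) \<in> graph_span \<Gamma>"
  | lincomb: "(u, w) \<in> graph_span \<Gamma> \<Longrightarrow> (u', w') \<in> graph_span \<Gamma> \<Longrightarrow>
      (a *\<^sub>R u + b *\<^sub>R u', \<lambda>x. a *\<^sub>R w x + b *\<^sub>R w' x) \<in> graph_span \<Gamma>"

definition graph_closure :: "('h::real_normed_vector \<times> ('g \<Rightarrow> 'h)) set \<Rightarrow> ('h \<times> ('g \<Rightarrow> 'h)) set"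
  where "graph_closure \<Gamma> = {(u, w). \<exists>us ws. (\<forall>n. (us n, ws n) \<in> \<Gamma>) \<and> us \<longlonglongrightarrow> u \<and>
    (\<forall>x. (\<lambda>n. ws n x) \<longlonglongrightarrow> w x)}"

lemma graph_closureE:
  assumes "(u, w) \<in> graph_closure \<Gamma>"
  obtains us ws where "\<And>n. (us n, ws n) \<in> \<Gamma>" "us \<longlonglongrightarrow> u" "\<And>x. (\<lambda>n. ws n x) \<longlonglongrightarrow> w x"
  using assms by (auto simp: graph_closure_def)

lemma graph_closureI:
  "(\<And>n. (us n, ws n) \<in> \<Gamma>) \<Longrightarrow> us \<longlonglongrightarrow> u \<Longrightarrow> (\<And>x. (\<lambda>n. ws n x) \<longlonglongrightarrow> w x) \<Longrightarrow>
   (u, w) \<in> graph_closure \<Gamma>"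
  by (auto simp: graph_closure_def)

lemma graph_closure_lincomb:
  assumes "(u, w) \<in> graph_closure (graph_span \<Gamma>)" and "(u', w') \<in> graph_closure (graph_span \<Gamma>)"
  shows "(a *\<^sub>R u + b *\<^sub>R u', \<lambda>x. a *\<^sub>R w x + b *\<^sub>R w' x) \<in> graph_closure (graph_span \<Gamma>)"
proof -
  obtain us ws where 1: "\<And>n. (us n, ws n) \<in> graph_span \<Gamma>" "us \<longlonglongrightarrow> u" "\<And>x. (\<lambda>n. ws n x) \<longlonglongrightarrow> w x"
    using assms(1) by (rule graph_closureE) blast
  obtain us' ws' where 2: "\<And>n. (us' n, ws' n) \<in> graph_span \<Gamma>" "us' \<longlonglongrightarrow> u'"
      "\<And>x. (\<lambda>n. ws' n x) \<longlonglongrightarrow> w' x"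
    using assms(2) by (rule graph_closureE) blast
  show ?thesis
  proof (rule graph_closureI[where us = "\<lambda>n. a *\<^sub>R us n + b *\<^sub>R us' n"
        and ws = "\<lambda>n x. a *\<^sub>R ws n x + b *\<^sub>R ws' n x"])
    show "(a *\<^sub>R us n + b *\<^sub>R us' n, \<lambda>x. a *\<^sub>R ws n x + b *\<^sub>R ws' n x) \<in> graph_span \<Gamma>" for n
      by (intro graph_span.lincomb 1 2)
  qed (intro tendsto_intros 1 2)+
qed

context symmetric_cosine
begin

lemma sine_graph_span:
  assumes \<Gamma>: "sine_graph \<Gamma>"
  shows "sine_graph (graph_span \<Gamma>)"
proof (rule sine_graphI)
  have base: "ip (w x) (w' y) = ip (D x y u) u' \<and> ip (w x) u' = ip u (w' x)"
    if "(u, w) \<in> \<Gamma>" "(u', w') \<in> graph_span \<Gamma>" for u w u' w' x y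
    using that(2,1)
    by (induction rule: graph_span.induct)
      (auto simp: sine_graph_gram[OF \<Gamma>] sine_graph_symmetric[OF \<Gamma>] ip_simps)
  show "ip (w x) (w' y) = ip (D x y u) u' \<and> ip (w x) u' = ip u (w' x)"
    if "(u, w) \<in> graph_span \<Gamma>" "(u', w') \<in> graph_span \<Gamma>" for u w u' w' x y
    using that
    by (induction rule: graph_span.induct) (auto simp: base ip_simps blinfun.bilinear_simps)
  show "(J u, \<lambda>x. J (w x)) \<in> graph_span \<Gamma>" if "(u, w) \<in> graph_span \<Gamma>" for u w
    using that
  proof (induction rule: graph_span.induct)
    case zero
    then show ?case
      using graph_span.zero by (simp add: blinfun.bilinear_simps)
  next
    case (base u w)
    then show ?case
      using sine_graph_J[OF \<Gamma>] by (blast intro: graph_span.base)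
  next
    case (lincomb u w u' w' a b)
    then show ?case
      using graph_span.lincomb[OF lincomb.IH, of a b] by (simp add: blinfun.bilinear_simps)
  qed
qed

lemma sine_graph_closure:
  assumes \<Gamma>: "sine_graph \<Gamma>"
  shows "sine_graph (graph_closure \<Gamma>)"
proof (rule sine_graphI)
  fix u w u' w' x y
  assume "(u, w) \<in> graph_closure \<Gamma>" "(u', w') \<in> graph_closure \<Gamma>"
  then obtain us ws us' ws' where 1: "\<And>n. (us n, ws n) \<in> \<Gamma>" "us \<longlonglongrightarrow> u" "\<And>x. (\<lambda>n. ws n x) \<longlonglongrightarrow> w x"
    and 2: "\<And>n. (us' n, ws' n) \<in> \<Gamma>" "us' \<longlonglongrightarrow> u'" "\<And>x. (\<lambda>n. ws' n x) \<longlonglongrightarrow> w' x"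
    by (elim graph_closureE) blast
  have "(\<lambda>n. ip (ws n x) (ws' n y)) \<longlonglongrightarrow> ip (w x) (w' y)"
    "(\<lambda>n. ip (D x y (us n)) (us' n)) \<longlonglongrightarrow> ip (D x y u) u'"
    "(\<lambda>n. ip (ws n x) (us' n)) \<longlonglongrightarrow> ip (w x) u'"
    "(\<lambda>n. ip (us n) (ws' n x)) \<longlonglongrightarrow> ip u (w' x)"
    by (intro tendsto_ip tendsto_intros 1 2)+
  then show "ip (w x) (w' y) = ip (D x y u) u' \<and> ip (w x) u' = ip u (w' x)"
    using sine_graph_gram[OF \<Gamma> 1(1) 2(1), of _ x _ y] sine_graph_symmetric[OF \<Gamma> 1(1) 2(1), of _ x]
    by (auto intro: LIMSEQ_unique)
next
  fix u w assume "(u, w) \<in> graph_closure \<Gamma>"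
  then obtain us ws where 1: "\<And>n. (us n, ws n) \<in> \<Gamma>" "us \<longlonglongrightarrow> u" "\<And>x. (\<lambda>n. ws n x) \<longlonglongrightarrow> w x"
    by (elim graph_closureE) blast
  show "(J u, \<lambda>x. J (w x)) \<in> graph_closure \<Gamma>"
  proof (rule graph_closureI[where us = "\<lambda>n. J (us n)" and ws = "\<lambda>n x. J (ws n x)"])
    show "(J (us n), \<lambda>x. J (ws n x)) \<in> \<Gamma>" for n
      by (rule sine_graph_J[OF \<Gamma> 1(1)])
  qed (intro tendsto_intros 1)+
qed

text \<open>
  The domain is dense, since nothing is orthogonal to it; and along a sequence of arguments that
  converges, the values converge as well, by the Gram condition.
\<close>

lemma graph_closure_total:
  assumes \<Gamma>: "sine_graph \<Gamma>" and total: "perp \<Gamma> = {0}"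
  shows "\<exists>w. (u, w) \<in> graph_closure (graph_span \<Gamma>)"
proof -
  let ?\<Lambda> = "graph_span \<Gamma>"
  have \<Lambda>: "sine_graph ?\<Lambda>"
    by (rule sine_graph_span[OF \<Gamma>])
  have "closure (fst ` ?\<Lambda>) = UNIV"
  proof (rule dense_if_orthogonal_trivial)
    show "subspace (fst ` ?\<Lambda>)"
      unfolding subspace_def
    proof (intro conjI ballI allI)
      show "0 \<in> fst ` ?\<Lambda>"
        using graph_span.zero[of \<Gamma>] by force
      show "a + b \<in> fst ` ?\<Lambda>" if "a \<in> fst ` ?\<Lambda>" "b \<in> fst ` ?\<Lambda>" for a b
        using that graph_span.lincomb[of _ _ \<Gamma> _ _ 1 1] by force
      show "c *\<^sub>R a \<in> fst ` ?\<Lambda>" if "a \<in> fst ` ?\<Lambda>" for a c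
        using that graph_span.lincomb[of _ _ \<Gamma> _ _ c 0] by force
    qed
    fix v assume "\<And>u. u \<in> fst ` ?\<Lambda> \<Longrightarrow> ip u v = 0"
    then have "v \<in> perp \<Gamma>"
      by (force simp: perp_def intro: graph_span.base)
    then show "v = 0"
      using total by simp
  qed
  then have "u \<in> closure (fst ` ?\<Lambda>)"
    by simp
  then obtain us where us: "\<And>n. us n \<in> fst ` ?\<Lambda>" "us \<longlonglongrightarrow> u"
    unfolding closure_sequential by blast
  then have "\<forall>n. \<exists>w. (us n, w) \<in> ?\<Lambda>"
    by force
  then obtain ws where ws: "\<And>n. (us n, ws n) \<in> ?\<Lambda>"
    by metis
  have "convergent (\<lambda>n. ws n x)" for x
  proof -
    obtain L where L: "\<And>(T :: 'h \<Rightarrow>\<^sub>L 'h) u a. ip a a = ip (blinfun_apply T u) u \<Longrightarrow>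
        norm a \<le> L * sqrt (norm T) * norm u"
      using norm_bound_if_ip_eq by blast
    have "ip (ws m x - ws n x) (ws m x - ws n x) = ip (D x x (us m - us n)) (us m - us n)" for m n
      using sine_graph_gram[OF \<Lambda> graph_span.lincomb[OF ws[of m] ws[of n], of 1 "-1"]
          graph_span.lincomb[OF ws[of m] ws[of n], of 1 "-1"], of x x] by simp
    then have "dist (ws m x) (ws n x) \<le> L * sqrt (norm (D x x)) * dist (us m) (us n)" for m n
      unfolding dist_norm by (rule L)
    then have "Cauchy (\<lambda>n. ws n x)"
      by (rule Cauchy_if_dist_le[OF LIMSEQ_imp_Cauchy[OF us(2)]])
    then show ?thesis
      by (simp add: Cauchy_convergent_iff)
  qed
  then have "\<forall>x. \<exists>l. (\<lambda>n. ws n x) \<longlonglongrightarrow> l"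
    by (simp add: convergent_def)
  then obtain w where "\<And>x. (\<lambda>n. ws n x) \<longlonglongrightarrow> w x"
    by metis
  then show ?thesis
    using graph_closureI[OF ws us(2)] by blast
qed

lemma sine_exists:
  obtains S :: "'g \<Rightarrow> 'h \<Rightarrow>\<^sub>L 'h" where "\<And>x. symmetric (S x)"
    and "\<And>x y u. S x (S y u) = D x y u" and "\<And>x u. J (S x u) = S x (J u)"
proof -
  obtain \<Gamma> where \<Gamma>: "sine_graph \<Gamma>" "perp \<Gamma> = {0}"
    by (rule total_sine_graph_exists)
  define C where "C = graph_closure (graph_span \<Gamma>)"
  have C: "sine_graph C"
    unfolding C_def by (intro sine_graph_closure sine_graph_span \<Gamma>)
  have total: "\<exists>w. (u, w) \<in> C" for u
    unfolding C_def by (rule graph_closure_total[OF \<Gamma>])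
  have lincomb: "(a *\<^sub>R u + b *\<^sub>R u', \<lambda>x. a *\<^sub>R w x + b *\<^sub>R w' x) \<in> C"
    if "(u, w) \<in> C" "(u', w') \<in> C" for u w u' w' a b
    using graph_closure_lincomb that unfolding C_def by blast
  have unique: "w x = w' x" if "(u, w) \<in> C" "(u, w') \<in> C" for u w w' x
  proof -
    have "(0, \<lambda>x. w x - w' x) \<in> C"
      using lincomb[OF that, of 1 "-1"] by simp
    from sine_graph_gram[OF C this this, of x x] show ?thesis
      by simp
  qed
  define s where "s x u = (SOME w. (u, w) \<in> C) x" for x u
  have s: "(u, \<lambda>x. s x u) \<in> C" for u
    using someI_ex[OF total[of u]] by (simp add: s_def)
  have s_lincomb: "s x (a *\<^sub>R u + b *\<^sub>R v) = a *\<^sub>R s x u + b *\<^sub>R s x v" for a b u v x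
    using unique[OF s lincomb[OF s s]] .
  have "bounded_linear (s x)" for x
  proof -
    obtain L where L: "\<And>(T :: 'h \<Rightarrow>\<^sub>L 'h) u a. ip a a = ip (blinfun_apply T u) u \<Longrightarrow>
        norm a \<le> L * sqrt (norm T) * norm u"
      using norm_bound_if_ip_eq by blast
    show ?thesis
    proof (rule bounded_linear_intro[of _ "L * sqrt (norm (D x x))"])
      show "s x (u + v) = s x u + s x v" for u v
        using s_lincomb[of x 1 u 1 v] by simp
      show "s x (r *\<^sub>R u) = r *\<^sub>R s x u" for r u
        using s_lincomb[of x r u 0 u] by simp
      show "norm (s x u) \<le> norm u * (L * sqrt (norm (D x x)))" for u
        using L[OF sine_graph_gram[OF C s s]] by (simp add: mult_ac)
    qed
  qed
  then have app: "blinfun_apply (Blinfun (s x)) u = s x u" for x u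
    by (simp add: bounded_linear_Blinfun_apply)
  have sym: "ip (s x u) v = ip u (s x v)" for x u v
    by (rule sine_graph_symmetric[OF C s s])
  show ?thesis
  proof (rule that[of "\<lambda>x. Blinfun (s x)"])
    show "symmetric (Blinfun (s x))" for x
      by (simp add: symmetric_def app sym)
    show "Blinfun (s x) (Blinfun (s y) u) = D x y u" for x y u
    proof (rule ip_eqI)
      fix v
      have "ip (s x (s y u)) v = ip (D y x u) v"
        unfolding sym[of x] by (rule sine_graph_gram[OF C s s])
      then show "ip (Blinfun (s x) (Blinfun (s y) u)) v = ip (D x y u) v"
        by (simp add: app D_commute[of x])
    qed
    show "J (Blinfun (s x) u) = Blinfun (s x) (J u)" for x u
      using unique[OF sine_graph_J[OF C s] s] by (simp add: app)
  qed
qed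

end

locale cosine_sine = symmetric_cosine ip \<Phi> J
  for ip :: "'h::banach \<Rightarrow> 'h \<Rightarrow> real" and \<Phi> :: "'g::ab_group_add \<Rightarrow> ('h \<Rightarrow>\<^sub>L 'h)" and J +
  fixes S :: "'g \<Rightarrow> 'h \<Rightarrow>\<^sub>L 'h"
  assumes S_symmetric: "symmetric (S x)"
    and S_S: "S x (S y u) = D x y u"
    and J_S: "J (S x u) = S x (J u)"
begin

lemma S_0: "S 0 u = 0"
proof -
  have "ip (S 0 u) (S 0 u) = ip u (D 0 0 u)"
    by (simp add: symmetricD[OF S_symmetric] S_S)
  then show ?thesis
    by (simp add: D_diag \<Phi>_0)
qed

text \<open>
  The pattern of this proof is repeated below: a vector \<open>t\<close> in a sum of ranges of the \<open>S x\<close> with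
  \<open>S z t = 0\<close> for all \<open>z\<close> is orthogonal to these ranges, hence zero. The products \<open>S z t\<close> are
  expressed by \<open>\<Phi>\<close> alone.
\<close>

lemma S_minus: "S (- x) u = - S x u"
proof -
  define t where "t = S (- x) u + S x u"
  have S_t: "S z t = 0" for z
    by (simp add: t_def blinfun.add_right S_S D_commute[of z] D_minus)
  have "ip t t = ip (S (- x) t) u + ip (S x t) u"
    by (subst (2) t_def) (simp add: ip_add_right symmetricD[OF S_symmetric])
  then have "t = 0"
    by (simp add: S_t)
  then show ?thesis
    by (simp add: t_def eq_neg_iff_add_eq_0)
qed

lemma S_addition: "S (x + y) u = S x (\<Phi> y u) + S y (\<Phi> x u)"
proof -
  define t where "t = S (x + y) u - S x (\<Phi> y u) - S y (\<Phi> x u)"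
  have D_addition: "D z (x + y) u = D z x (\<Phi> y u) + D z y (\<Phi> x u)" for z
  proof -
    have args: "z + x + y = z + (x + y)" "z - x - y = z - (x + y)" "z + y + x = z + (x + y)"
      "z - y - x = z - (x + y)" "z - y + x = z + x - y" "z + y - x = z - x + y"
      by (simp_all add: algebra_simps)
    have sum: "a + p - q - b + (b + p - q - a) = 2 *\<^sub>R (p - q)" for a b p q :: 'h
      by (simp add: scaleR_2 algebra_simps)
    have "4 *\<^sub>R D z x (\<Phi> y u) =
        \<Phi> (z - x + y) u + \<Phi> (z - (x + y)) u - \<Phi> (z + (x + y)) u - \<Phi> (z + x - y) u"
      "4 *\<^sub>R D z y (\<Phi> x u) =
        \<Phi> (z + x - y) u + \<Phi> (z - (x + y)) u - \<Phi> (z + (x + y)) u - \<Phi> (z - x + y) u"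
      by (simp_all only: D_apply cosine args) (simp_all add: scaleR_add_right scaleR_diff_right)
    then have "4 *\<^sub>R (D z x (\<Phi> y u) + D z y (\<Phi> x u)) = 2 *\<^sub>R (\<Phi> (z - (x + y)) u - \<Phi> (z + (x + y)) u)"
      by (simp only: scaleR_add_right sum)
    then have "4 *\<^sub>R (D z x (\<Phi> y u) + D z y (\<Phi> x u)) = 4 *\<^sub>R D z (x + y) u"
      by (simp add: D_apply)
    then show ?thesis
      by simp
  qed
  have S_t: "S z t = 0" for z
    by (simp add: t_def blinfun.diff_right S_S D_addition)
  have "ip t t = ip (S (x + y) t) u - ip (S x t) (\<Phi> y u) - ip (S y t) (\<Phi> x u)"
    by (subst (2) t_def) (simp add: ip_diff_right symmetricD[OF S_symmetric])
  then have "t = 0"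
    by (simp add: S_t)
  then show ?thesis
    by (simp add: t_def algebra_simps)
qed

lemma S_\<Phi>: "S y (\<Phi> x u) = (1/2) *\<^sub>R (S (y + x) u + S (y - x) u)"
proof -
  have "S (y + x) u + S (y - x) u = 2 *\<^sub>R S y (\<Phi> x u)"
    using S_addition[of y x u] S_addition[of y "- x" u] by (simp add: S_minus \<Phi>_even scaleR_2)
  then show ?thesis
    by simp
qed

text \<open>
  The preceding formula expresses \<open>S y \<Phi> x\<close> by symmetric operators; so it equals its adjoint, which is
  \<open>\<Phi> x S y\<close>.
\<close>

lemma S_\<Phi>_commute: "S y (\<Phi> x u) = \<Phi> x (S y u)"
proof (rule ip_eqI)
  fix v
  have "ip (\<Phi> x (S y u)) v = ip u (S y (\<Phi> x v))"
    by (simp add: symmetricD[OF S_symmetric] symmetricD[OF \<Phi>_symmetric])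
  also have "\<dots> = ip (S y (\<Phi> x u)) v"
    by (simp add: S_\<Phi> ip_simps symmetricD[OF S_symmetric])
  finally show "ip (S y (\<Phi> x u)) v = ip (\<Phi> x (S y u)) v"
    by simp
qed

lemma S_norm_le: "\<exists>K. \<forall>x. norm (S x) \<le> K * sqrt (norm (D x x))"
proof -
  obtain L where L: "\<And>(T :: 'h \<Rightarrow>\<^sub>L 'h) u a. ip a a = ip (blinfun_apply T u) u \<Longrightarrow>
      norm a \<le> L * sqrt (norm T) * norm u" and "L \<ge> 0"
    using norm_bound_if_ip_eq by blast
  have "norm (S x) \<le> L * sqrt (norm (D x x))" for x
  proof (rule norm_blinfun_bound)
    show "norm (S x u) \<le> L * sqrt (norm (D x x)) * norm u" for u
      by (rule L) (simp add: symmetricD[OF S_symmetric] S_S D_symmetric)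
  qed (use \<open>L \<ge> 0\<close> in simp)
  then show ?thesis
    by blast
qed

text \<open>
  Euler's formula \<open>e\<^sup>\<i>\<^sup>x = cos x + \<i> sin x\<close>.
\<close>

definition M :: "'g \<Rightarrow> 'h \<Rightarrow>\<^sub>L 'h"
  where "M x = \<Phi> x + (J o\<^sub>L S x)"

lemma M_apply: "M x u = \<Phi> x u + J (S x u)"
  by (simp add: M_def blinfun.bilinear_simps)

lemma M_0: "M 0 = id_blinfun"
  by (rule blinfun_eqI) (simp add: M_apply \<Phi>_0 S_0 blinfun.bilinear_simps)

lemma cosine_eq_M: "\<Phi> x = (1/2) *\<^sub>R (M x + M (- x))"
  by (rule blinfun_eqI)
    (simp add: M_apply S_minus \<Phi>_even blinfun.bilinear_simps flip: scaleR_left_distrib)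

lemma M_add:
  assumes JJ: "\<And>u. J (J u) = - u"
  shows "M (x + y) = M x o\<^sub>L M y"
proof (rule blinfun_eqI)
  fix u
  have "M x (M y u) = \<Phi> x (\<Phi> y u) - D x y u + J (S x (\<Phi> y u) + S y (\<Phi> x u))"
    by (simp add: M_apply blinfun.add_right J_\<Phi>[symmetric] J_S[symmetric] JJ S_S
        S_\<Phi>_commute[of y x])
  also have "J (S x (\<Phi> y u) + S y (\<Phi> x u)) = J (S (x + y) u)"
    by (simp add: S_addition)
  also have "\<Phi> x (\<Phi> y u) - D x y u = \<Phi> (x + y) u"
    by (simp add: cosine D_apply scaleR_add_right scaleR_diff_right flip: scaleR_left_distrib)
  finally show "M (x + y) u = (M x o\<^sub>L M y) u"
    by (simp add: M_apply)
qed

end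

section \<open>Bounded cosine functions on complex Hilbert spaces\<close>

definition re_inner :: "'h::complex_hilbert \<Rightarrow> 'h \<Rightarrow> real"
  where "re_inner u v = Re (cinner u v)"

lemma re_inner_add_left: "re_inner (u + v) w = re_inner u w + re_inner v w"
  by (simp add: re_inner_def cinner_add_left)

lemma re_inner_scale_left: "re_inner (r *\<^sub>R u) w = r * re_inner u w"
  by (simp add: re_inner_def scaleR_scaleC cinner_scaleC_left)

lemma re_inner_commute: "re_inner u v = re_inner v u"
  unfolding re_inner_def by (subst cinner_commute) simp

lemma re_inner_add_right: "re_inner w (u + v) = re_inner w u + re_inner w v"
  by (simp add: re_inner_commute[of w] re_inner_add_left)

lemma re_inner_scale_right: "re_inner w (r *\<^sub>R u) = r * re_inner w u"
  by (simp add: re_inner_commute[of w] re_inner_scale_left)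

lemma re_inner_self: "re_inner u u = (norm u)\<^sup>2"
  by (simp add: re_inner_def cinner_self)

lemma re_inner_scaleC_\<i>: "re_inner (\<i> *\<^sub>C u) v = - re_inner u (\<i> *\<^sub>C v)"
proof -
  have "cinner u (\<i> *\<^sub>C v) = cnj (\<i> * cinner v u)"
    by (subst cinner_commute) (simp add: cinner_scaleC_left)
  also have "\<dots> = - (\<i> * cinner u v)"
    using cinner_commute[of u v] by simp
  finally show ?thesis
    by (simp add: re_inner_def cinner_scaleC_left)
qed

lemma re_inner_polarization: "re_inner u v = ((norm (u + v))\<^sup>2 - (norm (u - v))\<^sup>2) / 4"
proof -
  have "(norm (u + v))\<^sup>2 = re_inner u u + 2 * re_inner u v + re_inner v v"
    unfolding re_inner_self[symmetric]
    by (simp add: re_inner_add_left re_inner_add_right re_inner_commute[of v u])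
  moreover have "(norm (u + (-1) *\<^sub>R v))\<^sup>2 = re_inner u u - 2 * re_inner u v + re_inner v v"
    unfolding re_inner_self[symmetric] re_inner_add_left re_inner_add_right re_inner_scale_left
      re_inner_scale_right by (simp add: re_inner_commute[of v u])
  ultimately show ?thesis
    by simp
qed

lemma abs_re_inner_le: "\<bar>re_inner u v\<bar> \<le> (norm u + norm v)\<^sup>2"
proof -
  have "(norm (u + v))\<^sup>2 \<le> (norm u + norm v)\<^sup>2" "(norm (u - v))\<^sup>2 \<le> (norm u + norm v)\<^sup>2"
    by (intro power_mono norm_triangle_ineq norm_triangle_ineq4 norm_ge_zero)+
  moreover have "0 \<le> (norm (u + v))\<^sup>2" "0 \<le> (norm (u - v))\<^sup>2"
    by simp_all
  moreover have "\<bar>(a - b) / 4\<bar> \<le> s" if "a \<le> s" "b \<le> s" "0 \<le> a" "0 \<le> b" for a b s :: real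
    using that by (simp add: abs_le_iff)
  ultimately show ?thesis
    unfolding re_inner_polarization by blast
qed

definition imaginary_unit :: "'h::complex_hilbert \<Rightarrow>\<^sub>L 'h"
  where "imaginary_unit = Blinfun (\<lambda>u. \<i> *\<^sub>C u)"

lemma scaleC_\<i>_\<i>: "\<i> *\<^sub>C \<i> *\<^sub>C u = - u"
  using scaleR_scaleC[of "-1" u] by (simp add: scaleC_scaleC)

lemma imaginary_unit_apply: "imaginary_unit u = \<i> *\<^sub>C u"
proof -
  have "(norm (\<i> *\<^sub>C v))\<^sup>2 = (norm v)\<^sup>2" for v :: 'a
    using re_inner_scaleC_\<i>[of v "\<i> *\<^sub>C v"] re_inner_scale_right[of v "-1" v]
    by (simp add: scaleC_\<i>_\<i> re_inner_self)
  then have "bounded_linear (\<lambda>v::'a. \<i> *\<^sub>C v)"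
    by (intro bounded_linear_intro[of _ 1])
      (simp_all add: scaleC_add_right scaleR_scaleC scaleC_scaleC mult.commute)
  then show ?thesis
    by (simp add: imaginary_unit_def bounded_linear_Blinfun_apply)
qed

lemma imaginary_unit_imaginary_unit: "imaginary_unit (imaginary_unit u) = - u"
  by (simp add: imaginary_unit_apply scaleC_\<i>_\<i>)

lemma scaleC_conv_imaginary_unit: "c *\<^sub>C u = Re c *\<^sub>R u + Im c *\<^sub>R imaginary_unit u"
proof -
  have "c = complex_of_real (Re c) + complex_of_real (Im c) * \<i>"
    by (simp add: complex_eq_iff)
  then have "c *\<^sub>C u = (complex_of_real (Re c) + complex_of_real (Im c) * \<i>) *\<^sub>C u"
    by (rule arg_cong)
  then show ?thesis
    by (simp only: scaleC_add_left imaginary_unit_apply scaleR_scaleC scaleC_scaleC)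
qed

text \<open>
  Complex linearity of a real linear operator is commutation with multiplication by \<open>\<i>\<close>.
\<close>

lemma bounded_operators_iff:
  "T \<in> bounded_operators \<longleftrightarrow> (\<forall>u. imaginary_unit (T u) = T (imaginary_unit u))"
  by (auto simp: bounded_operators_def scaleC_conv_imaginary_unit blinfun.bilinear_simps
      imaginary_unit_apply[symmetric] dest: spec[of _ \<i>])

text \<open>
  If \<open>\<Phi> x u\<close> is small, then \<open>\<Phi> (2 x) u = 2 (\<Phi> x)\<^sup>2 u - u\<close> is close to \<open>- u\<close>. If this holds for
  \<open>x\<close>, \<open>y\<close>, \<open>x + y\<close> and \<open>x - y\<close>, then \<open>\<Phi> (2 x + 2 y) u + \<Phi> (2 x - 2 y) u\<close> is close to \<open>- 2 u\<close>, while
  \<open>2 \<Phi> (2 x) \<Phi> (2 y) u\<close> is close to \<open>2 u\<close>; the cosine equation identifies the two. So \<open>u\<close> is bounded by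
  these four values of \<open>\<Phi>\<close>, and \<open>\<Phi> x u\<close> cannot be small on average.
\<close>

lemma cosine_twice_estimate:
  fixes \<Phi> :: "'g::topological_ab_group_add \<Rightarrow> ('h::complex_hilbert \<Rightarrow>\<^sub>L 'h)"
  assumes cosine: "\<And>x y u. \<Phi> (x + y) u + \<Phi> (x - y) u = 2 *\<^sub>R \<Phi> x (\<Phi> y u)"
    and \<Phi>_0: "\<And>u. \<Phi> 0 u = u"
    and K: "K \<ge> 0" "\<And>x. norm (\<Phi> x) \<le> K"
  shows "(norm u)\<^sup>2 \<le> 4 * K\<^sup>2 * ((norm (\<Phi> x u))\<^sup>2 + K\<^sup>2 * (norm (\<Phi> y u))\<^sup>2 +
    (norm (\<Phi> (x + y) u))\<^sup>2 / 4 + (norm (\<Phi> (x - y) u))\<^sup>2 / 4)"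
proof -
  define e where "e z = 2 *\<^sub>R \<Phi> z (\<Phi> z u)" for z
  have e: "\<Phi> (z + z) u = e z - u" for z
    using cosine[of z z u] by (simp add: e_def \<Phi>_0 algebra_simps)
  have le: "norm (\<Phi> z v) \<le> K * norm v" for z v
    using norm_blinfun[of "\<Phi> z" v] mult_right_mono[OF K(2)[of z], of "norm v"] by simp
  then have norm_e: "norm (e z) \<le> 2 * K * norm (\<Phi> z u)" for z
    by (simp add: e_def)
  have "\<Phi> (x + x + (y + y)) u + \<Phi> (x + x - (y + y)) u = 2 *\<^sub>R \<Phi> (x + x) (\<Phi> (y + y) u)"
    by (rule cosine)
  also have "\<Phi> (x + x + (y + y)) u = e (x + y) - u"
    using e[of "x + y"] by (simp add: algebra_simps)
  also have "\<Phi> (x + x - (y + y)) u = e (x - y) - u"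
    using e[of "x - y"] by (simp add: algebra_simps)
  also have "\<Phi> (x + x) (\<Phi> (y + y) u) = \<Phi> (x + x) (e y) - (e x - u)"
    by (simp add: e blinfun.diff_right)
  finally have "4 *\<^sub>R u = e (x + y) + e (x - y) + 2 *\<^sub>R e x - 2 *\<^sub>R \<Phi> (x + x) (e y)"
    using scaleR_add_left[of 2 2 u] by (simp add: algebra_simps scaleR_2)
  then have "4 * norm u = norm (e (x + y) + e (x - y) + 2 *\<^sub>R e x - 2 *\<^sub>R \<Phi> (x + x) (e y))"
    by (metis norm_scaleR abs_numeral)
  also have "\<dots> \<le> norm (e (x + y)) + norm (e (x - y)) + norm (2 *\<^sub>R e x) + norm (2 *\<^sub>R \<Phi> (x + x) (e y))"
    by (intro order_trans[OF norm_triangle_ineq4] add_mono order_trans[OF norm_triangle_ineq] order_refl)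
  also have "\<dots> \<le> 2 * K * norm (\<Phi> (x + y) u) + 2 * K * norm (\<Phi> (x - y) u)
      + 2 * (2 * K * norm (\<Phi> x u)) + 2 * (K * (2 * K * norm (\<Phi> y u)))"
  proof -
    have "norm (\<Phi> (x + x) (e y)) \<le> K * (2 * K * norm (\<Phi> y u))"
      by (rule order_trans[OF le mult_left_mono[OF norm_e K(1)]])
    then show ?thesis
      using norm_e[of x] by (intro add_mono norm_e) simp_all
  qed
  finally have "norm u \<le> K * (norm (\<Phi> x u) + K * norm (\<Phi> y u) + norm (\<Phi> (x + y) u) / 2 + norm (\<Phi> (x - y) u) / 2)"
    by (simp add: algebra_simps)
  then have "(norm u)\<^sup>2 \<le> (K * (norm (\<Phi> x u) + K * norm (\<Phi> y u) + norm (\<Phi> (x + y) u) / 2 + norm (\<Phi> (x - y) u) / 2))\<^sup>2"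
    by (rule power_mono) simp
  also have "\<dots> \<le> K\<^sup>2 * (4 * ((norm (\<Phi> x u))\<^sup>2 + (K * norm (\<Phi> y u))\<^sup>2 +
      (norm (\<Phi> (x + y) u) / 2)\<^sup>2 + (norm (\<Phi> (x - y) u) / 2)\<^sup>2))"
  proof -
    have "(a + b + c + d)\<^sup>2 \<le> 4 * (a\<^sup>2 + b\<^sup>2 + c\<^sup>2 + d\<^sup>2)" for a b c d :: real
      using zero_le_power2[of "a - b"] zero_le_power2[of "a - c"] zero_le_power2[of "a - d"]
        zero_le_power2[of "b - c"] zero_le_power2[of "b - d"] zero_le_power2[of "c - d"]
      by (simp add: power2_eq_square algebra_simps)
    then show ?thesis
      unfolding power_mult_distrib[of K "_ + _"] by (rule mult_left_mono) simp
  qed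
  finally show ?thesis
    by (simp add: power_mult_distrib power_divide field_simps)
qed

text \<open>
  The inner product is the mean over \<open>x\<close> of \<open>\<langle>\<Phi> x u, \<Phi> x v\<rangle>\<close>. Replacing \<open>u\<close> by \<open>\<Phi> y u\<close> turns \<open>\<Phi> x\<close> into
  \<open>(\<Phi> (x + y) + \<Phi> (x - y)) / 2\<close>, and a shift of \<open>x\<close> moves \<open>y\<close> to the other argument, which gives symmetry;
  convexity of the square of the norm gives contractivity.
\<close>

lemma symmetrizing_inner_product_exists:
  fixes \<Phi> :: "'g::topological_ab_group_add \<Rightarrow> ('h::complex_hilbert \<Rightarrow>\<^sub>L 'h)"
  assumes cf: "cosine_function \<Phi>" and bounded: "uniformly_bounded \<Phi>"
  obtains ip where "symmetric_cosine ip \<Phi> imaginary_unit"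
proof -
  have cosine2: "\<Phi> (x + y) u + \<Phi> (x - y) u = 2 *\<^sub>R \<Phi> x (\<Phi> y u)" for x y u
  proof -
    have "(\<Phi> (x + y) + \<Phi> (x - y)) u = (2 *\<^sub>R (\<Phi> x o\<^sub>L \<Phi> y)) u"
      using cf by (simp add: cosine_function_def)
    then show ?thesis
      by (simp add: blinfun.bilinear_simps)
  qed
  have cosine: "\<Phi> x (\<Phi> y u) = (1/2) *\<^sub>R (\<Phi> (x + y) u + \<Phi> (x - y) u)" for x y u
    by (simp add: cosine2)
  have \<Phi>_0: "\<Phi> 0 u = u" for u
    using cf by (simp add: cosine_function_def)
  have cont: "continuous_on UNIV \<Phi>" and ops: "\<And>x. \<Phi> x \<in> bounded_operators"
    using cf by (auto simp: cosine_function_def)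
  obtain K where K: "\<And>x. norm (\<Phi> x) \<le> K"
    using bounded by (auto simp: uniformly_bounded_def bdd_above_def)
  have K0: "K \<ge> 0"
    using K[of 0] norm_ge_zero order_trans by blast
  have le: "norm (\<Phi> z v) \<le> K * norm v" for z v
    using norm_blinfun[of "\<Phi> z" v] mult_right_mono[OF K[of z], of "norm v"] by simp
  obtain m :: "('g \<Rightarrow> real) \<Rightarrow> real" where m: "invariant_mean m"
    using invariant_mean_exists by blast
  have m_add: "m (\<lambda>x. f x + g x) = m f + m g" if "f \<in> bcontfun" "g \<in> bcontfun" for f g
    using m that unfolding invariant_mean_def by blast
  have m_mult: "m (\<lambda>x. r * f x) = r * m f" if "f \<in> bcontfun" for f r
    using m that unfolding invariant_mean_def by blast
  have m_mono: "m f \<le> m g" if "f \<in> bcontfun" "g \<in> bcontfun" "\<And>x. f x \<le> g x" for f g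
    using m that unfolding invariant_mean_def by blast
  have m_const: "m (\<lambda>x. c) = c" for c
    using m unfolding invariant_mean_def by blast
  have m_shift: "m (\<lambda>x. f (x + y)) = m f" if "f \<in> bcontfun" for f y
    using m that unfolding invariant_mean_def by blast
  define f where "f a b u v = (\<lambda>x. re_inner (\<Phi> (x + a) u) (\<Phi> (x + b) v))" for a b u v
  have f_bcont: "f a b u v \<in> bcontfun" for a b u v
    unfolding bcontfun_def
  proof safe
    have shifted: "continuous_on UNIV (\<lambda>x. \<Phi> (x + c) w)" for c w
    proof -
      have "continuous_on UNIV (\<lambda>x. \<Phi> (x + c))"
        by (intro continuous_on_compose2[OF cont] continuous_intros) auto
      then show ?thesis
        by (intro continuous_intros)
    qed
    show "continuous_on UNIV (f a b u v)"
      unfolding f_def re_inner_polarization by (intro continuous_intros shifted) auto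
    have "\<bar>f a b u v x\<bar> \<le> (K * norm u + K * norm v)\<^sup>2" for x
      unfolding f_def
      by (rule order_trans[OF abs_re_inner_le]) (intro power_mono add_mono le add_nonneg_nonneg norm_ge_zero)
    then show "bounded (range (f a b u v))"
      by (intro boundedI[of _ "(K * norm u + K * norm v)\<^sup>2"]) auto
  qed
  have const_bcont: "(\<lambda>x. c) \<in> bcontfun" for c :: real
    by (rule const_bcontfun)
  have mult_bcont: "(\<lambda>x. c * h x) \<in> bcontfun" if "h \<in> bcontfun" for c and h :: "'g \<Rightarrow> real"
    using scaleR_cont[OF that, of c] by simp
  define E where "E a b u v = m (f a b u v)" for a b u v
  define ip where "ip = E 0 0"
  have E_shift: "E (a + c) (b + c) u v = E a b u v" for a b c u v
    using m_shift[OF f_bcont, of a b u v c] by (simp add: E_def f_def add_ac)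
  have ip_add: "ip (u + v) w = ip u w + ip v w" for u v w
  proof -
    have "f 0 0 (u + v) w = (\<lambda>x. f 0 0 u w x + f 0 0 v w x)"
      by (simp add: f_def fun_eq_iff blinfun.add_right re_inner_add_left)
    then show ?thesis
      unfolding ip_def E_def by (simp only: m_add[OF f_bcont f_bcont])
  qed
  have ip_scale: "ip (r *\<^sub>R u) w = r * ip u w" for r u w
  proof -
    have "f 0 0 (r *\<^sub>R u) w = (\<lambda>x. r * f 0 0 u w x)"
      by (simp add: f_def fun_eq_iff blinfun.scaleR_right re_inner_scale_left)
    then show ?thesis
      unfolding ip_def E_def by (simp only: m_mult[OF f_bcont])
  qed
  have f_commute: "f a b u v = f b a v u" for a b u v
    by (simp add: f_def fun_eq_iff re_inner_commute)
  have ip_commute: "ip u v = ip v u" for u v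
    unfolding ip_def E_def by (subst f_commute) simp
  have f_diag: "f a a u u x = (norm (\<Phi> (x + a) u))\<^sup>2" for a u x
    by (simp add: f_def re_inner_self)
  have E_diag: "E a a u u = ip u u" for a u
    using E_shift[of 0 a 0 u u] by (simp add: ip_def)
  have upper: "ip u u \<le> K\<^sup>2 * (norm u)\<^sup>2" for u
  proof -
    have "m (f 0 0 u u) \<le> m (\<lambda>x. K\<^sup>2 * (norm u)\<^sup>2)"
      unfolding power_mult_distrib[symmetric]
      by (intro m_mono f_bcont const_bcont) (simp add: f_diag power_mono le)
    then show ?thesis
      by (simp add: ip_def E_def m_const)
  qed
  \<comment> \<open>The estimate for two arguments is averaged over \<open>x\<close> first, then over \<open>y\<close>.\<close>
  have lower: "(norm u)\<^sup>2 \<le> (6 * K\<^sup>2 + 4 * K\<^sup>2 * K\<^sup>2) * ip u u" for u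
  proof -
    have inner: "(norm u)\<^sup>2 \<le> 4 * K\<^sup>2 * (ip u u + K\<^sup>2 * (norm (\<Phi> y u))\<^sup>2 + ip u u / 4 + ip u u / 4)" for y
    proof -
      let ?rhs = "\<lambda>x. (4 * K\<^sup>2) * (f 0 0 u u x + (K\<^sup>2 * (norm (\<Phi> y u))\<^sup>2 +
        ((1/4) * f y y u u x + (1/4) * f (- y) (- y) u u x)))"
      have "m (\<lambda>x. (norm u)\<^sup>2) \<le> m ?rhs"
      proof (rule m_mono)
        show "?rhs \<in> bcontfun"
          by (intro mult_bcont plus_cont f_bcont const_bcont)
        show "(norm u)\<^sup>2 \<le> ?rhs x" for x
          using cosine_twice_estimate[of \<Phi> K u x y, OF cosine2 \<Phi>_0 K0 K] by (simp add: f_diag add.assoc)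
      qed (rule const_bcont)
      also have "m ?rhs = (4 * K\<^sup>2) * (E 0 0 u u + (K\<^sup>2 * (norm (\<Phi> y u))\<^sup>2 +
        ((1/4) * E y y u u + (1/4) * E (- y) (- y) u u)))"
        unfolding E_def
        by (simp only: m_mult m_add m_const mult_bcont plus_cont f_bcont const_bcont)
      finally show ?thesis
        by (simp add: m_const E_diag)
    qed
    let ?A = "4 * K\<^sup>2 * (ip u u + ip u u / 2)"
    have "m (\<lambda>y. (norm u)\<^sup>2) \<le> m (\<lambda>y. ?A + (4 * K\<^sup>2 * K\<^sup>2) * f 0 0 u u y)"
    proof (rule m_mono)
      show "(\<lambda>y. ?A + (4 * K\<^sup>2 * K\<^sup>2) * f 0 0 u u y) \<in> bcontfun"
        by (intro mult_bcont plus_cont f_bcont const_bcont)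
      show "(norm u)\<^sup>2 \<le> ?A + (4 * K\<^sup>2 * K\<^sup>2) * f 0 0 u u y" for y
        using inner[of y] by (simp add: f_diag algebra_simps)
    qed (rule const_bcont)
    also have "m (\<lambda>y. ?A + (4 * K\<^sup>2 * K\<^sup>2) * f 0 0 u u y) = ?A + (4 * K\<^sup>2 * K\<^sup>2) * ip u u"
      unfolding ip_def E_def
      by (simp only: m_mult m_add m_const mult_bcont plus_cont f_bcont const_bcont)
    finally show ?thesis
      by (simp add: m_const algebra_simps)
  qed
  interpret equivalent_inner ip
  proof
    let ?L = "6 * K\<^sup>2 + 4 * K\<^sup>2 * K\<^sup>2"
    have nonneg: "0 \<le> ip u u" for u
      using m_mono[OF const_bcont[of 0] f_bcont[of 0 0 u u]] by (simp add: f_diag ip_def E_def m_const)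
    have "(norm u)\<^sup>2 \<le> (?L + 1) * ip u u" for u
      using lower[of u] nonneg[of u] by (simp add: distrib_right)
    moreover have "?L + 1 > 0"
      by (simp add: add_nonneg_pos)
    ultimately have "1 / (?L + 1) * (norm u)\<^sup>2 \<le> ip u u" for u
      by (simp add: divide_le_eq mult.commute)
    then show "\<exists>c>0. \<forall>u. c * (norm u)\<^sup>2 \<le> ip u u"
      using \<open>?L + 1 > 0\<close> by (intro exI[of _ "1 / (?L + 1)"]) auto
    show "\<exists>C. \<forall>u. ip u u \<le> C * (norm u)\<^sup>2"
      using upper by blast
  qed (fact ip_add ip_scale ip_commute)+
  have "symmetric_cosine ip \<Phi> imaginary_unit"
  proof
    show "\<Phi> x (\<Phi> y u) = (1/2) *\<^sub>R (\<Phi> (x + y) u + \<Phi> (x - y) u)" for x y u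
      by (rule cosine)
    show "\<Phi> 0 u = u" for u
      by (rule \<Phi>_0)
    show "imaginary_unit (\<Phi> x u) = \<Phi> x (imaginary_unit u)" for x u
      using ops[of x] by (simp add: bounded_operators_iff)
    show "ip (imaginary_unit u) v = - ip u (imaginary_unit v)" for u v
    proof -
      have "f 0 0 (imaginary_unit u) v = (\<lambda>x. (-1) * f 0 0 u (imaginary_unit v) x)"
        using ops by (simp add: f_def fun_eq_iff bounded_operators_def imaginary_unit_apply re_inner_scaleC_\<i>)
      then show ?thesis
        unfolding ip_def E_def by (simp add: m_mult[OF f_bcont, of "-1", simplified])
    qed
    have half: "f 0 0 (\<Phi> y u) v = (\<lambda>x. (1/2) * (f y 0 u v x + f (- y) 0 u v x))" for y u v
      by (simp add: f_def fun_eq_iff cosine re_inner_scale_left re_inner_add_left)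
    have ip_\<Phi>: "ip (\<Phi> y u) v = (1/2) * (E y 0 u v + E (- y) 0 u v)" for y u v
      unfolding ip_def E_def half by (simp only: m_mult m_add plus_cont f_bcont)
    show "symmetric (\<Phi> y)" for y
      unfolding symmetric_def
    proof (intro allI)
      fix u v
      have "E y 0 u v = E (- y) 0 v u" "E (- y) 0 u v = E y 0 v u"
        using E_shift[of y "- y" 0 u v] E_shift[of "- y" y 0 u v]
        by (simp_all add: E_def f_commute[of 0])
      then show "ip (\<Phi> y u) v = ip u (\<Phi> y v)"
        by (simp add: ip_commute[of u] ip_\<Phi>)
    qed
    show "nrm (\<Phi> y u) \<le> nrm u" for y u
    proof -
      have "m (f 0 0 (\<Phi> y u) (\<Phi> y u)) \<le> m (\<lambda>x. (1/2) * (f y y u u x + f (- y) (- y) u u x))"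
      proof (rule m_mono)
        show "(\<lambda>x. (1/2) * (f y y u u x + f (- y) (- y) u u x)) \<in> bcontfun"
          by (intro mult_bcont plus_cont f_bcont)
        fix x
        let ?a = "\<Phi> (x + y) u" and ?b = "\<Phi> (x - y) u"
        have "f 0 0 (\<Phi> y u) (\<Phi> y u) x = (norm (?a + ?b))\<^sup>2 / 4"
          by (simp add: f_diag cosine power_divide)
        also have "\<dots> \<le> (norm ?a + norm ?b)\<^sup>2 / 4"
          by (intro divide_right_mono power_mono norm_triangle_ineq) simp_all
        also have "\<dots> \<le> ((norm ?a)\<^sup>2 + (norm ?b)\<^sup>2) / 2"
          using zero_le_power2[of "norm ?a - norm ?b"] by (simp add: power2_eq_square algebra_simps)
        finally show "f 0 0 (\<Phi> y u) (\<Phi> y u) x \<le> (1/2) * (f y y u u x + f (- y) (- y) u u x)"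
          by (simp add: f_diag)
      qed (rule f_bcont)
      also have "\<dots> = (1/2) * (E y y u u + E (- y) (- y) u u)"
        unfolding E_def by (simp only: m_mult m_add plus_cont f_bcont)
      also have "\<dots> = ip u u"
        by (simp add: E_diag)
      finally have "ip (\<Phi> y u) (\<Phi> y u) \<le> ip u u"
        by (simp only: ip_def E_def)
      then show ?thesis
        by (simp add: nrm_def)
    qed
  qed
  then show ?thesis
    by (rule that)
qed

text \<open>
  Continuity of \<open>M\<close> at \<open>a\<close> follows from that at \<open>0\<close> through \<open>M x = M a M (x - a)\<close>, and the latter from the
  bound of \<open>S x\<close> by the square root of \<open>D x x\<close>, which tends to \<open>D 0 0 = 0\<close>.
\<close>

lemma bounded_cosine_function_representation:
  fixes \<Phi> :: "'g::topological_ab_group_add \<Rightarrow> ('h::complex_hilbert \<Rightarrow>\<^sub>L 'h)"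
  assumes cf: "cosine_function \<Phi>" and bounded: "uniformly_bounded \<Phi>"
  shows "\<exists>M. multiplicative_operator M \<and> (\<forall>x. \<Phi> x = (1/2) *\<^sub>R (M x + M (- x)))"
proof -
  let ?J = "imaginary_unit :: 'h \<Rightarrow>\<^sub>L 'h"
  have cont: "continuous_on UNIV \<Phi>" and \<Phi>_0: "\<Phi> 0 = id_blinfun"
    using cf by (auto simp: cosine_function_def)
  obtain ip where "symmetric_cosine ip \<Phi> ?J"
    using symmetrizing_inner_product_exists[OF assms] .
  then interpret symmetric_cosine ip \<Phi> ?J .
  obtain S :: "'g \<Rightarrow> 'h \<Rightarrow>\<^sub>L 'h" where S: "\<And>x. symmetric (S x)" "\<And>x y u. S x (S y u) = D x y u"
    "\<And>x u. ?J (S x u) = S x (?J u)"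
    by (rule sine_exists) blast
  interpret cosine_sine ip \<Phi> ?J S
    by unfold_locales (fact S)+
  have M_add': "M (x + y) = M x o\<^sub>L M y" for x y
    by (rule M_add) (rule imaginary_unit_imaginary_unit)
  have \<Phi>_lim: "(\<Phi> \<longlongrightarrow> \<Phi> 0) (nhds 0)"
    using cont by (simp add: continuous_on_def tendsto_at_iff_tendsto_nhds)
  note compose_lim = bounded_bilinear.tendsto[OF bounded_bilinear_blinfun_compose]
  obtain K where K: "\<And>x. norm (S x) \<le> K * sqrt (norm (D x x))"
    using S_norm_le by blast
  have D_eq: "D x x = id_blinfun - (\<Phi> x o\<^sub>L \<Phi> x)" for x
    by (rule blinfun_eqI) (simp add: D_diag blinfun.bilinear_simps)
  have "((\<lambda>x. K * sqrt (norm (D x x))) \<longlongrightarrow> K * sqrt (norm (D 0 0))) (nhds 0)"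
    unfolding D_eq by (intro tendsto_intros compose_lim \<Phi>_lim)
  moreover have "D 0 0 = 0"
    by (rule blinfun_eqI) (simp add: D_apply)
  ultimately have "((\<lambda>x. K * sqrt (norm (D x x))) \<longlongrightarrow> 0) (nhds 0)"
    by simp
  then have "(S \<longlongrightarrow> 0) (nhds 0)"
    by (rule Lim_null_comparison[rotated]) (simp add: K)
  moreover have "S 0 = 0"
    by (rule blinfun_eqI) (simp add: S_0)
  ultimately have "(M \<longlongrightarrow> M 0) (nhds 0)"
    unfolding M_def by (intro tendsto_intros compose_lim \<Phi>_lim) simp
  moreover have "((\<lambda>x. x - a) \<longlongrightarrow> 0) (nhds a)" for a :: 'g
    using tendsto_diff[OF filterlim_ident tendsto_const, of a a] by simp
  ultimately have "((\<lambda>x. M (x - a)) \<longlongrightarrow> M 0) (nhds a)" for a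
    by (rule filterlim_compose)
  then have "((\<lambda>x. M a o\<^sub>L M (x - a)) \<longlongrightarrow> M a o\<^sub>L M 0) (nhds a)" for a
    by (intro compose_lim tendsto_const)
  then have "(M \<longlongrightarrow> M a) (nhds a)" for a
    by (simp flip: M_add')
  then have "continuous_on UNIV M"
    by (simp add: continuous_on_def tendsto_at_iff_tendsto_nhds)
  moreover have "M x \<in> bounded_operators" for x
    by (simp add: bounded_operators_iff M_apply blinfun.bilinear_simps J_\<Phi> J_S)
  ultimately have "multiplicative_operator M"
    unfolding multiplicative_operator_def using M_add' M_0 by blast
  then show ?thesis
    using cosine_eq_M by blast
qed

theorem theorem4p2:
  fixes \<Phi> :: "'g::topological_ab_group_add \<Rightarrow> ('h::complex_hilbert \<Rightarrow>\<^sub>L 'h)"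
  assumes "locally_compact_space (euclidean :: 'g topology)"
    and "cosine_function \<Phi>"
    and "uniformly_bounded \<Phi>"
  shows "\<exists>S\<in>bounded_operators. \<exists>S_inv\<in>bounded_operators. \<exists>M :: 'g \<Rightarrow> ('h \<Rightarrow>\<^sub>L 'h).
    S o\<^sub>L S_inv = id_blinfun \<and> S_inv o\<^sub>L S = id_blinfun \<and>
    multiplicative_operator M \<and>
    (\<forall>x. \<Phi> x = S o\<^sub>L ((1/2) *\<^sub>R (M x + M (- x))) o\<^sub>L S_inv)"
proof -
  obtain M where M: "multiplicative_operator M" "\<And>x. \<Phi> x = (1/2) *\<^sub>R (M x + M (- x))"
    using bounded_cosine_function_representation[OF assms(2,3)] by blast
  have id: "id_blinfun \<in> bounded_operators"
    by (simp add: bounded_operators_def)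
  have compose_id: "id_blinfun o\<^sub>L T o\<^sub>L id_blinfun = T" for T :: "'h \<Rightarrow>\<^sub>L 'h"
    by (rule blinfun_eqI) simp
  have "id_blinfun o\<^sub>L id_blinfun = (id_blinfun :: 'h \<Rightarrow>\<^sub>L 'h)"
    by (rule blinfun_eqI) simp
  then show ?thesis
    using id M compose_id by (intro bexI[of _ id_blinfun] exI[of _ M]) auto
qed

end
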